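(* There is no combinatorial pentagonal tiling of the sphere with exactly one vertex of degree $>3$.
   Context: A combinatorial pentagonal tiling of the sphere is a finite graph (multiple edges are allowed a priori) embedded in the $2$-sphere, dividing the sphere into regions called tiles that are homeomorphic to the disk, such that the boundary of every tile is a simple closed path consisting of exactly five edges of the graph, and every vertex has degree $\ge 3$. *)

theory Defs
  imports "HOL-Analysis.Analysis"
begin

abbreviation S2 :: "(real^3) set"
  where "S2 \<equiv> sphere 0 1"

definition edge_interior :: "(real \<Rightarrow> real^3) \<Rightarrow> (real^3) set"
  where "edge_interior g = g ` {0<..<1}"

text \<open>An edge is given by a parametrization over the unit interval. Since different edges have
  disjoint interiors, a set of parametrizations contains every geometric edge only once, while
  several edges may share both end points. A \<^const>\<open>simple_path\<close> may have
  coinciding end points, so loops are not excluded here.\<close>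

definition embedded_graph :: "(real^3) set \<Rightarrow> (real \<Rightarrow> real^3) set \<Rightarrow> bool"
  where "embedded_graph V E \<longleftrightarrow>
    finite V \<and> V \<subseteq> S2 \<and> finite E \<and>
    (\<forall>g\<in>E. simple_path g \<and> path_image g \<subseteq> S2 \<and>
            pathstart g \<in> V \<and> pathfinish g \<in> V \<and> edge_interior g \<inter> V = {}) \<and>
    (\<forall>g\<in>E. \<forall>h\<in>E. g \<noteq> h \<longrightarrow> edge_interior g \<inter> edge_interior h = {})"

definition graph_points :: "(real^3) set \<Rightarrow> (real \<Rightarrow> real^3) set \<Rightarrow> (real^3) set"
  where "graph_points V E = V \<union> (\<Union>g\<in>E. path_image g)"

text \<open>The two summands make a loop count twice.\<close>

definition vertex_degree :: "(real \<Rightarrow> real^3) set \<Rightarrow> real^3 \<Rightarrow> nat"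
  where "vertex_degree E v = card {g \<in> E. pathstart g = v} + card {g \<in> E. pathfinish g = v}"

definition tiles :: "(real^3) set \<Rightarrow> (real \<Rightarrow> real^3) set \<Rightarrow> (real^3) set set"
  where "tiles V E = components (S2 - graph_points V E)"

definition oriented_edges :: "(real \<Rightarrow> real^3) set \<Rightarrow> (real \<Rightarrow> real^3) set"
  where "oriented_edges E = E \<union> reversepath ` E"

text \<open>The five edges need not be required to be distinct: this follows from simplicity of the
  composed path.\<close>

definition pentagonal_boundary :: "(real \<Rightarrow> real^3) set \<Rightarrow> (real^3) set \<Rightarrow> bool"
  where "pentagonal_boundary E T \<longleftrightarrow>
    (\<exists>a b c d e. {a, b, c, d, e} \<subseteq> oriented_edges E \<and>
       pathfinish a = pathstart b \<and> pathfinish b = pathstart c \<and> pathfinish c = pathstart d \<and>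
       pathfinish d = pathstart e \<and> pathfinish e = pathstart a \<and>
       simple_path (a +++ b +++ c +++ d +++ e) \<and>
       top_of_set S2 frontier_of T = path_image (a +++ b +++ c +++ d +++ e))"

definition pentagonal_tiling :: "(real^3) set \<Rightarrow> (real \<Rightarrow> real^3) set \<Rightarrow> bool"
  where "pentagonal_tiling V E \<longleftrightarrow>
    embedded_graph V E \<and>
    (\<forall>T \<in> tiles V E. T homeomorphic ball (0 :: real^2) 1 \<and> pentagonal_boundary E T) \<and>
    (\<forall>v\<in>V. vertex_degree E v \<ge> 3)"

end

theory Submission
  imports Defs
begin

text \<open>A flag of the tiling is an incident triple of vertex, edge and tile. Label the flags of each tile
  by symmetries of the dodecahedron, compatibly with moving along the boundary of the tile; an edge is
  bad if the labels of its two tiles do not match across it. Around a vertex of degree three the last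
  edge matches if the other two do, so in the subgraph of bad edges only the exceptional vertex \<open>v\<close>
  can have degree one. Hence, if there is a bad edge, then there is a cycle of bad edges, and by the Jordan
  curve theorem one can relabel all tiles on one side of it by a common symmetry so that there are fewer
  bad edges than before. A labelling with the least number of bad edges therefore has none: it is a
  combinatorial map from the tiling to the dodecahedron.

  Unfold the dodecahedron into the tiling, starting from a flag at \<open>v\<close>. The
  labels show that no dodecahedron vertex other than the initial one is sent to \<open>v\<close>, so the nineteen
  other vertices close up with three tiles each. This forces the tiles around \<open>v\<close> to close up after
  three steps, and since the link of \<open>v\<close> is connected, \<open>v\<close> has degree three.\<close>

section \<open>The dodecahedron\<close>

text \<open>Away from \<open>v\<close> the tiling looks like the dodecahedron, and the sphere minus
  \<open>v\<close> is simply connected, so a developing map should exist. A labelling without bad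
  edges is such a map, and the Jordan curve theorem stands in for simple connectivity: a forest with
  an edge has at least two leaves, so a single vertex that may be a leaf cannot prevent a cycle of
  bad edges. Labels multiply on the left when the flag moves within its tile. Composition on the
  right with a fixed bijection is therefore free on each tile, and this freedom is spent on removing
  bad edges. The labelling alone does not settle the degree of \<open>v\<close>: it only makes it a
  multiple of three, as for a cover branched at \<open>v\<close>. Branching over a single point
  remains to be excluded. The dodecahedron without one vertex still lifts to the tiling, and a path
  around that vertex can be pushed over the nineteen others, so it closes as well.\<close>

text \<open>The flags of the regular dodecahedron form a torsor under its symmetry group, which acts on the
  twenty vertices; \<open>refl0\<close>, \<open>refl1\<close>, \<open>refl2\<close> are the reflections in the
  walls of the chamber of a fixed flag, opposite to its vertex, edge and face respectively, and
  vertex \<open>0\<close> is the vertex of that flag.\<close>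

definition refl0 :: "nat \<Rightarrow> nat" where
  "refl0 n = (if n < 20 then [8, 16, 2, 18, 9, 5, 13, 17, 0, 4, 14, 19, 12, 6, 10, 15, 1, 7, 3, 11] ! n else n)"

definition refl1 :: "nat \<Rightarrow> nat" where
  "refl1 n = (if n < 20 then [0, 14, 13, 12, 15, 16, 11, 7, 9, 8, 10, 6, 3, 2, 1, 4, 5, 18, 17, 19] ! n else n)"

definition refl2 :: "nat \<Rightarrow> nat" where
  "refl2 n = (if n < 20 then [0, 13, 15, 11, 14, 12, 16, 7, 8, 10, 9, 3, 5, 1, 4, 2, 6, 17, 19, 18] ! n else n)"

lemma refl0_values:
  "refl0 0 = 8" "refl0 (Suc 0) = 16" "refl0 2 = 2" "refl0 3 = 18" "refl0 4 = 9"
  "refl0 5 = 5" "refl0 6 = 13" "refl0 7 = 17" "refl0 8 = 0" "refl0 9 = 4"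
  "refl0 10 = 14" "refl0 11 = 19" "refl0 12 = 12" "refl0 13 = 6" "refl0 14 = 10"
  "refl0 15 = 15" "refl0 16 = Suc 0" "refl0 17 = 7" "refl0 18 = 3" "refl0 19 = 11"
  by (simp_all add: refl0_def)

lemma refl1_values:
  "refl1 0 = 0" "refl1 (Suc 0) = 14" "refl1 2 = 13" "refl1 3 = 12" "refl1 4 = 15"
  "refl1 5 = 16" "refl1 6 = 11" "refl1 7 = 7" "refl1 8 = 9" "refl1 9 = 8"
  "refl1 10 = 10" "refl1 11 = 6" "refl1 12 = 3" "refl1 13 = 2" "refl1 14 = Suc 0"
  "refl1 15 = 4" "refl1 16 = 5" "refl1 17 = 18" "refl1 18 = 17" "refl1 19 = 19"
  by (simp_all add: refl1_def)

lemma refl2_values: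
  "refl2 0 = 0" "refl2 (Suc 0) = 13" "refl2 2 = 15" "refl2 3 = 11" "refl2 4 = 14"
  "refl2 5 = 12" "refl2 6 = 16" "refl2 7 = 7" "refl2 8 = 8" "refl2 9 = 10"
  "refl2 10 = 9" "refl2 11 = 3" "refl2 12 = 5" "refl2 13 = Suc 0" "refl2 14 = 4"
  "refl2 15 = 2" "refl2 16 = 6" "refl2 17 = 17" "refl2 18 = 19" "refl2 19 = 18"
  by (simp_all add: refl2_def)

lemmas refl_values = refl0_values refl1_values refl2_values

lemma refl_ge: "20 \<le> n \<Longrightarrow> refl0 n = n" "20 \<le> n \<Longrightarrow> refl1 n = n" "20 \<le> n \<Longrightarrow> refl2 n = n"
  by (simp_all add: refl0_def refl1_def refl2_def)

lemma less_20_cases: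
  fixes n :: nat
  obtains "20 \<le> n" | "n \<in> {0, Suc 0, 2, 3, 4, 5, 6, 7, 8, 9, 10, 11, 12, 13, 14, 15, 16, 17, 18, 19}"
proof (cases "20 \<le> n")
  case False
  then have "n \<in> {..<20}"
    by simp
  then show ?thesis
    by (intro that(2)) (auto simp: lessThan_nat_numeral lessThan_Suc)
qed (use that in blast)

text \<open>With the next three lemmas, these are the Coxeter relations of type H3, with products of
  order 2, 5 and 3. The reflections are the identity from 20 on, so the relations hold on all of
  \<open>nat\<close> and labels can be composed and inverted without a domain condition.\<close>

lemma refl_involution:
  "refl0 (refl0 n) = n" "refl1 (refl1 n) = n" "refl2 (refl2 n) = n"
  by (cases n rule: less_20_cases; auto simp: refl_ge refl_values)+

lemma refl_commute: "refl0 (refl2 n) = refl2 (refl0 n)"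
  by (cases n rule: less_20_cases) (auto simp: refl_ge refl_values)

lemma refl_face:
  "refl1 (refl0 (refl1 (refl0 (refl1 n)))) = refl0 (refl1 (refl0 (refl1 (refl0 n))))"
  by (cases n rule: less_20_cases) (auto simp: refl_ge refl_values)

lemma refl_vertex: "refl1 (refl2 (refl1 (refl2 (refl1 (refl2 n))))) = n"
  by (cases n rule: less_20_cases) (auto simp: refl_ge refl_values)

lemma funpow_small: "(f ^^ 2) z = f (f z)" "(f ^^ 3) z = f (f (f z))" "(f ^^ 4) z = f (f (f (f z)))"
  by (simp_all add: eval_nat_numeral)

text \<open>\<open>P\<close> rotates a flag about its face and \<open>Q\<close> about its edge; the last assumption says that the
  vertex of \<open>x\<close> has degree three, and \<open>c x\<close> is the vertex of the dodecahedron to which the label of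
  \<open>x\<close> sends the vertex \<open>0\<close>.\<close>

lemma dodecahedron_develop:
  fixes P Q :: "'a \<Rightarrow> 'a" and c :: "'a \<Rightarrow> nat"
  assumes x0: "x0 \<in> D" "c x0 = 0"
    and closed: "\<And>x. x \<in> D \<Longrightarrow> P x \<in> D" "\<And>x. x \<in> D \<Longrightarrow> Q x \<in> D"
    and P5: "\<And>x. x \<in> D \<Longrightarrow> (P ^^ 5) x = x"
    and QQ: "\<And>x. x \<in> D \<Longrightarrow> Q (Q x) = x"
    and cP: "\<And>x. x \<in> D \<Longrightarrow> c (P x) = refl0 (refl1 (c x))"
    and cQ: "\<And>x. x \<in> D \<Longrightarrow> c (Q x) = refl0 (refl2 (c x))"
    and vertex: "\<And>x. x \<in> D \<Longrightarrow> c x \<noteq> 0 \<Longrightarrow> Q ((P ^^ 4) (Q ((P ^^ 4) (Q x)))) = P x"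
  shows "Q ((P ^^ 4) (Q ((P ^^ 4) (Q x0)))) = P x0"
proof -
  \<comment> \<open>One flag for each face of the dodecahedron other than that of \<open>x0\<close>:
    \<open>b1\<close> to \<open>b5\<close> lie across the five sides of that face, \<open>b6\<close>
    to \<open>b10\<close> on the second ring, and \<open>b11\<close> on the opposite face.\<close>
  define b1 b2 b3 b4 b5 where "b1 = Q x0" and "b2 = Q (P x0)" and "b3 = Q ((P ^^ 2) x0)"
    and "b4 = Q ((P ^^ 3) x0)" and "b5 = Q ((P ^^ 4) x0)"
  define b6 b7 b8 b9 b10 where "b6 = Q ((P ^^ 2) b1)" and "b7 = Q ((P ^^ 3) b1)"
    and "b8 = Q ((P ^^ 3) b2)" and "b9 = Q ((P ^^ 3) b3)" and "b10 = Q ((P ^^ 3) b4)"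
  define b11 where "b11 = Q ((P ^^ 3) b6)"
  note bs = b1_def b2_def b3_def b4_def b5_def b6_def b7_def b8_def b9_def b10_def b11_def
  define b where "b = (!) [x0, b1, b2, b3, b4, b5, b6, b7, b8, b9, b10, b11]"
  define y where "y i k = (P ^^ (k mod 5)) (b i)" for i k
  have powD: "(P ^^ k) x \<in> D" if "x \<in> D" for k x
    using that by (induction k) (auto simp: closed)
  have bD: "b i \<in> D" if "i < 12" for i
  proof -
    have "\<forall>x\<in>set [x0, b1, b2, b3, b4, b5, b6, b7, b8, b9, b10, b11]. x \<in> D"
      by (simp add: bs x0 closed powD)
    moreover have "b i \<in> set [x0, b1, b2, b3, b4, b5, b6, b7, b8, b9, b10, b11]"
      unfolding b_def by (rule nth_mem) (use that in simp)
    ultimately show ?thesis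
      by blast
  qed
  have yD: "y i k \<in> D" if "i < 12" for i k
    by (simp add: y_def bD powD that)
  have cpow: "c ((P ^^ k) x) = ((refl0 \<circ> refl1) ^^ k) (c x)" if "x \<in> D" for k x
    using that by (induction k) (auto simp: powD cP)
  have P5': "(P ^^ 5) z = P ((P ^^ 4) z)" for z
    by (simp add: eval_nat_numeral)
  have Py: "P (y i k) = y i ((k + 1) mod 5)" if "i < 12" for i k
  proof (cases "k mod 5 = 4")
    case True
    then have "Suc k mod 5 = 0"
      by presburger
    then show ?thesis
      using P5[OF bD[OF that]] by (simp add: y_def True P5')
  next
    case False
    then have "Suc k mod 5 = Suc (k mod 5)"
      by presburger
    then show ?thesis
      by (simp add: y_def)
  qed
  have P4y: "(P ^^ 4) (y i k) = y i ((k + 4) mod 5)" if "i < 12" for i k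
    by (simp add: funpow_small Py that mod_simps add.commute)
  \<comment> \<open>A walk around the vertex of \<open>y i k\<close> through the faces
    \<open>i\<close>, \<open>j\<close>, \<open>m\<close>. At a vertex of degree three the first two
    crossings determine the third. Adding 4 modulo 5 is one turn backwards.\<close>
  have turn: "Q (y m ((n + 4) mod 5)) = y i ((k + 1) mod 5) \<and>
      Q (y i ((k + 1) mod 5)) = y m ((n + 4) mod 5)"
    if "Q (y i k) = y j l" "Q (y j l') = y m n" "l' = (l + 4) mod 5" "c (y i k) \<noteq> 0"
      "i < 12" "j < 12" "m < 12" for i j k l l' m n
  proof -
    have "Q (y m ((n + 4) mod 5)) = y i ((k + 1) mod 5)"
      using vertex[OF yD that(4)] that by (simp add: P4y Py)
    then show ?thesis
      using QQ[OF yD] that(7) by metis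
  qed
  \<comment> \<open>Once \<open>c\<close> is known on the twelve base flags, the side conditions
    \<open>c (y i k) \<noteq> 0\<close> are decided by evaluation.\<close>
  have cy: "c (y i k) = ((refl0 \<circ> refl1) ^^ (k mod 5)) (c (b i))" if "i < 12" for i k
    by (simp add: y_def cpow bD that)
  have bsD: "b1 \<in> D" "b2 \<in> D" "b3 \<in> D" "b4 \<in> D" "b6 \<in> D"
    by (simp_all add: bs closed powD x0)
  have cb0: "c (b 0) = 0"
    by (simp add: b_def x0)
  have cb1: "c (b (Suc 0)) = 8"
    by (simp add: b_def b1_def cQ cP cpow powD closed bsD x0 funpow_small refl_values)
  have cb2: "c (b 2) = 0"
    by (simp add: b_def b2_def cQ cP cpow powD closed bsD x0 funpow_small refl_values)
  have cb3: "c (b 3) = 10"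
    by (simp add: b_def b3_def cQ cP cpow powD closed bsD x0 funpow_small refl_values)
  have cb4: "c (b 4) = 2"
    by (simp add: b_def b4_def cQ cP cpow powD closed bsD x0 funpow_small refl_values)
  have cb5: "c (b 5) = 14"
    by (simp add: b_def b5_def cQ cP cpow powD closed bsD x0 funpow_small refl_values)
  have cb6: "c (b 6) = 2"
    using cb1 by (simp add: b_def b6_def cQ cP cpow powD closed bsD x0 funpow_small refl_values)
  have cb7: "c (b 7) = 14"
    using cb1 by (simp add: b_def b7_def cQ cP cpow powD closed bsD x0 funpow_small refl_values)
  have cb8: "c (b 8) = 2"
    using cb2 by (simp add: b_def b8_def cQ cP cpow powD closed bsD x0 funpow_small refl_values)
  have cb9: "c (b 9) = 12"
    using cb3 by (simp add: b_def b9_def cQ cP cpow powD closed bsD x0 funpow_small refl_values)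
  have cb10: "c (b 10) = 18"
    using cb4 by (simp add: b_def b10_def cQ cP cpow powD closed bsD x0 funpow_small refl_values)
  have cb11: "c (b 11) = 18"
    using cb6 by (simp add: b_def b11_def cQ cP cpow powD closed bsD x0 funpow_small refl_values)
  note cb = cb0 cb1 cb2 cb3 cb4 cb5 cb6 cb7 cb8 cb9 cb10 cb11
  text \<open>The flag \<open>y i k\<close> is obtained from \<open>x0\<close> by moving to the \<open>i\<close>-th face along a spanning tree of
    the faces and then turning \<open>k\<close> times. The equations \<open>a1\<close> to \<open>a11\<close> are the edges of the tree; each
    further adjacency follows from two known ones at a vertex.\<close>
  have x0_y: "y 0 0 = x0"
    by (simp add: y_def b_def)
  have a1: "Q (y 0 0) = y 1 0" and b1: "Q (y 1 0) = y 0 0"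
    by (simp_all add: y_def b_def bs QQ closed powD x0)
  have a2: "Q (y 0 1) = y 2 0" and b2: "Q (y 2 0) = y 0 1"
    by (simp_all add: y_def b_def bs QQ closed powD x0)
  have a3: "Q (y 0 2) = y 3 0" and b3: "Q (y 3 0) = y 0 2"
    by (simp_all add: y_def b_def bs QQ closed powD x0)
  have a4: "Q (y 0 3) = y 4 0" and b4: "Q (y 4 0) = y 0 3"
    by (simp_all add: y_def b_def bs QQ closed powD x0)
  have a5: "Q (y 0 4) = y 5 0" and b5: "Q (y 5 0) = y 0 4"
    by (simp_all add: y_def b_def bs QQ closed powD x0)
  have a6: "Q (y 1 2) = y 6 0" and b6: "Q (y 6 0) = y 1 2"
    by (simp_all add: y_def b_def bs QQ closed powD x0)
  have a7: "Q (y 1 3) = y 7 0" and b7: "Q (y 7 0) = y 1 3"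
    by (simp_all add: y_def b_def bs QQ closed powD x0)
  have a8: "Q (y 2 3) = y 8 0" and b8: "Q (y 8 0) = y 2 3"
    by (simp_all add: y_def b_def bs QQ closed powD x0)
  have a9: "Q (y 3 3) = y 9 0" and b9: "Q (y 9 0) = y 3 3"
    by (simp_all add: y_def b_def bs QQ closed powD x0)
  have a10: "Q (y 4 3) = y 10 0" and b10: "Q (y 10 0) = y 4 3"
    by (simp_all add: y_def b_def bs QQ closed powD x0)
  have a11: "Q (y 6 3) = y 11 0" and b11: "Q (y 11 0) = y 6 3"
    by (simp_all add: y_def b_def bs QQ closed powD x0)
  \<comment> \<open>The edges not crossed by the tree of faces are nineteen in number and form a
    spanning tree of the twenty vertices. The order of the deductions peels off one leaf at a time,
    and the vertex left at the end is that of \<open>x0\<close>.\<close>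
  have d1: "Q (y 5 4) = y 1 1" and e1: "Q (y 1 1) = y 5 4"
    using turn[OF b1 a5] by (simp_all add: cy cb funpow_small refl_values flip: numeral_2_eq_2)
  have d2: "Q (y 2 4) = y 3 1" and e2: "Q (y 3 1) = y 2 4"
    using turn[OF b3 a2] by (simp_all add: cy cb funpow_small refl_values flip: numeral_2_eq_2)
  have d3: "Q (y 8 4) = y 3 2" and e3: "Q (y 3 2) = y 8 4"
    using turn[OF e2 a8] by (simp_all add: cy cb funpow_small refl_values flip: numeral_2_eq_2)
  have d4: "Q (y 3 4) = y 4 1" and e4: "Q (y 4 1) = y 3 4"
    using turn[OF b4 a3] by (simp_all add: cy cb funpow_small refl_values flip: numeral_2_eq_2)
  have d5: "Q (y 9 4) = y 4 2" and e5: "Q (y 4 2) = y 9 4"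
    using turn[OF e4 a9] by (simp_all add: cy cb funpow_small refl_values flip: numeral_2_eq_2)
  have d6: "Q (y 4 4) = y 5 1" and e6: "Q (y 5 1) = y 4 4"
    using turn[OF b5 a4] by (simp_all add: cy cb funpow_small refl_values flip: numeral_2_eq_2)
  have d7: "Q (y 10 4) = y 5 2" and e7: "Q (y 5 2) = y 10 4"
    using turn[OF e6 a10] by (simp_all add: cy cb funpow_small refl_values flip: numeral_2_eq_2)
  have d8: "Q (y 5 3) = y 6 1" and e8: "Q (y 6 1) = y 5 3"
    using turn[OF b6 e1] by (simp_all add: cy cb funpow_small refl_values flip: numeral_2_eq_2)
  have d9: "Q (y 10 3) = y 6 2" and e9: "Q (y 6 2) = y 10 3"
    using turn[OF e8 e7] by (simp_all add: cy cb funpow_small refl_values flip: numeral_2_eq_2)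
  have d10: "Q (y 6 4) = y 7 1" and e10: "Q (y 7 1) = y 6 4"
    using turn[OF b7 a6] by (simp_all add: cy cb funpow_small refl_values flip: numeral_2_eq_2)
  have d11: "Q (y 11 4) = y 7 2" and e11: "Q (y 7 2) = y 11 4"
    using turn[OF e10 a11] by (simp_all add: cy cb funpow_small refl_values flip: numeral_2_eq_2)
  have d12: "Q (y 8 3) = y 9 1" and e12: "Q (y 9 1) = y 8 3"
    using turn[OF b9 e3] by (simp_all add: cy cb funpow_small refl_values flip: numeral_2_eq_2)
  have d13: "Q (y 9 3) = y 10 1" and e13: "Q (y 10 1) = y 9 3"
    using turn[OF b10 e5] by (simp_all add: cy cb funpow_small refl_values flip: numeral_2_eq_2)
  have d14: "Q (y 10 2) = y 11 1" and e14: "Q (y 11 1) = y 10 2"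
    using turn[OF b11 e9] by (simp_all add: cy cb funpow_small refl_values flip: numeral_2_eq_2)
  have d15: "Q (y 9 2) = y 11 2" and e15: "Q (y 11 2) = y 9 2"
    using turn[OF e14 e13] by (simp_all add: cy cb funpow_small refl_values flip: numeral_2_eq_2)
  have d16: "Q (y 8 2) = y 11 3" and e16: "Q (y 11 3) = y 8 2"
    using turn[OF e15 e12] by (simp_all add: cy cb funpow_small refl_values flip: numeral_2_eq_2)
  have d17: "Q (y 8 1) = y 7 3" and e17: "Q (y 7 3) = y 8 1"
    using turn[OF e11 e16] by (simp_all add: cy cb funpow_small refl_values flip: numeral_2_eq_2)
  have d18: "Q (y 2 2) = y 7 4" and e18: "Q (y 7 4) = y 2 2"
    using turn[OF e17 b8] by (simp_all add: cy cb funpow_small refl_values flip: numeral_2_eq_2)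
  have d19: "Q (y 2 1) = y 1 4" and e19: "Q (y 1 4) = y 2 1"
    using turn[OF a7 e18] by (simp_all add: cy cb funpow_small refl_values flip: numeral_2_eq_2)
  \<comment> \<open>The faces \<open>0\<close>, \<open>1\<close>, \<open>2\<close> meet at the
    vertex of \<open>x0\<close>. All three crossings there are now known, although
    \<open>vertex\<close> is silent about it.\<close>
  have e0: "Q ((P ^^ 4) (y 2 1)) = P (y 0 0)"
    using b2 by (simp add: P4y Py)
  then show ?thesis
    using a1 e19 by (simp add: P4y flip: x0_y)
qed

section \<open>Combinatorial pentagonal maps\<close>

text \<open>The combinatorial shadow of a tiling, free of topology. \<open>ends\<close> yields a set
  because orientation never matters, and edges are objects of their own so that parallel edges stay
  distinct.\<close>

locale pentagonal_map =
  fixes E :: "'e set" and Tl :: "'t set" and ends :: "'e \<Rightarrow> 'v set" and bd :: "'t \<Rightarrow> 'e set"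
  assumes finite_E: "finite E"
    and bd_E: "T \<in> Tl \<Longrightarrow> bd T \<subseteq> E"
    and pentagon: "T \<in> Tl \<Longrightarrow> \<exists>v0 v1 v2 v3 v4 g0 g1 g2 g3 g4.
      distinct [v0, v1, v2, v3, v4] \<and> distinct [g0, g1, g2, g3, g4] \<and> bd T = {g0, g1, g2, g3, g4} \<and>
      ends g0 = {v0, v1} \<and> ends g1 = {v1, v2} \<and> ends g2 = {v2, v3} \<and> ends g3 = {v3, v4} \<and>
      ends g4 = {v4, v0}"
    and two_tiles: "e \<in> E \<Longrightarrow> card {T \<in> Tl. e \<in> bd T} = 2"
begin

section \<open>Flags of a pentagonal map\<close>

definition flags :: "('v \<times> 'e \<times> 't) set" where
  "flags = {(u, e, T). T \<in> Tl \<and> e \<in> bd T \<and> u \<in> ends e}"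

text \<open>With \<open>r1\<close> and \<open>r2\<close>, the adjacency involutions of the map. The
  definite descriptions are meaningful on flags only.\<close>

fun r0 :: "'v \<times> 'e \<times> 't \<Rightarrow> 'v \<times> 'e \<times> 't" where
  "r0 (u, e, T) = (THE u'. u' \<in> ends e \<and> u' \<noteq> u, e, T)"

fun r1 :: "'v \<times> 'e \<times> 't \<Rightarrow> 'v \<times> 'e \<times> 't" where
  "r1 (u, e, T) = (u, THE e'. e' \<in> bd T \<and> u \<in> ends e' \<and> e' \<noteq> e, T)"

fun r2 :: "'v \<times> 'e \<times> 't \<Rightarrow> 'v \<times> 'e \<times> 't" where
  "r2 (u, e, T) = (u, e, THE T'. T' \<in> Tl \<and> e \<in> bd T' \<and> T' \<noteq> T)"

lemma r0_eqI:
  assumes "u' \<noteq> u" "ends e = {u, u'} \<or> ends e = {u', u}"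
  shows "r0 (u, e, T) = (u', e, T)"
  using assms by (auto intro!: the_equality)

lemma r1_eqI:
  assumes "e' \<in> bd T" "u \<in> ends e'" "e' \<noteq> e" "\<forall>f\<in>bd T. u \<in> ends f \<longrightarrow> f = e \<or> f = e'"
  shows "r1 (u, e, T) = (u, e', T)"
  using assms by (auto intro!: the_equality)

text \<open>Tabulates the ten flags of a tile in cyclic order with their neighbours, so that a
  statement about a single tile becomes a check of ten cases.\<close>

lemma pentagon_flags:
  assumes "T \<in> Tl"
  obtains v0 v1 v2 v3 v4 g0 g1 g2 g3 g4
  where "distinct [v0, v1, v2, v3, v4]" "distinct [g0, g1, g2, g3, g4]"
    "{x \<in> flags. snd (snd x) = T} = {(v0, g0, T), (v1, g0, T), (v1, g1, T), (v2, g1, T), (v2, g2, T),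
      (v3, g2, T), (v3, g3, T), (v4, g3, T), (v4, g4, T), (v0, g4, T)}"
    "r0 (v0, g0, T) = (v1, g0, T)" "r0 (v1, g0, T) = (v0, g0, T)"
    "r0 (v1, g1, T) = (v2, g1, T)" "r0 (v2, g1, T) = (v1, g1, T)"
    "r0 (v2, g2, T) = (v3, g2, T)" "r0 (v3, g2, T) = (v2, g2, T)"
    "r0 (v3, g3, T) = (v4, g3, T)" "r0 (v4, g3, T) = (v3, g3, T)"
    "r0 (v4, g4, T) = (v0, g4, T)" "r0 (v0, g4, T) = (v4, g4, T)"
    "r1 (v0, g0, T) = (v0, g4, T)" "r1 (v1, g0, T) = (v1, g1, T)"
    "r1 (v1, g1, T) = (v1, g0, T)" "r1 (v2, g1, T) = (v2, g2, T)"
    "r1 (v2, g2, T) = (v2, g1, T)" "r1 (v3, g2, T) = (v3, g3, T)"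
    "r1 (v3, g3, T) = (v3, g2, T)" "r1 (v4, g3, T) = (v4, g4, T)"
    "r1 (v4, g4, T) = (v4, g3, T)" "r1 (v0, g4, T) = (v0, g0, T)"
proof -
  obtain v0 v1 v2 v3 v4 g0 g1 g2 g3 g4 where p:
    "distinct [v0, v1, v2, v3, v4]" "distinct [g0, g1, g2, g3, g4]" "bd T = {g0, g1, g2, g3, g4}"
    "ends g0 = {v0, v1}" "ends g1 = {v1, v2}" "ends g2 = {v2, v3}" "ends g3 = {v3, v4}"
    "ends g4 = {v4, v0}"
    using pentagon[OF assms] by (elim exE conjE) (rule that; assumption)
  from p(1,2) have d: "v0 \<noteq> v1" "v0 \<noteq> v2" "v0 \<noteq> v3" "v0 \<noteq> v4" "v1 \<noteq> v2" "v1 \<noteq> v3" "v1 \<noteq> v4"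
    "v2 \<noteq> v3" "v2 \<noteq> v4" "v3 \<noteq> v4" "g0 \<noteq> g1" "g0 \<noteq> g2" "g0 \<noteq> g3" "g0 \<noteq> g4" "g1 \<noteq> g2" "g1 \<noteq> g3"
    "g1 \<noteq> g4" "g2 \<noteq> g3" "g2 \<noteq> g4" "g3 \<noteq> g4"
    by simp_all
  note d = d d[symmetric]
  show thesis
  proof (rule that[OF p(1,2)], goal_cases)
    case 1
    have "{x \<in> flags. snd (snd x) = T} = (\<Union>e\<in>bd T. (\<lambda>u. (u, e, T)) ` ends e)"
      using assms by (auto simp: flags_def)
    then show ?case
      by (simp add: p(3-) insert_commute)
  qed ((rule r0_eqI r1_eqI; simp add: p(3-) d)+)
qed

lemma
  assumes "x \<in> flags"
  shows r0_r1_simps: "r0 x \<in> flags" "r0 (r0 x) = x" "fst (r0 x) \<noteq> fst x" "snd (r0 x) = snd x"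
    "r1 x \<in> flags" "r1 (r1 x) = x" "fst (snd (r1 x)) \<noteq> fst (snd x)" "fst (r1 x) = fst x"
    "snd (snd (r1 x)) = snd (snd x)"
    "r0 (r1 (r0 (r1 (r0 (r1 (r0 (r1 (r0 (r1 x))))))))) = x"
    and r0_r1_unique: "\<And>y. y \<in> flags \<Longrightarrow> snd (snd y) = snd (snd x) \<Longrightarrow> fst (snd y) = fst (snd x) \<Longrightarrow> y = x \<or> y = r0 x"
      "\<And>y. y \<in> flags \<Longrightarrow> snd (snd y) = snd (snd x) \<Longrightarrow> fst y = fst x \<Longrightarrow> y = x \<or> y = r1 x"
proof -
  obtain u e T where x: "x = (u, e, T)"
    by (cases x)
  have T: "T \<in> Tl"
    using assms x by (auto simp: flags_def)
  obtain v0 v1 v2 v3 v4 g0 g1 g2 g3 g4 where p: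
    "distinct [v0, v1, v2, v3, v4]" "distinct [g0, g1, g2, g3, g4]"
    "{x \<in> flags. snd (snd x) = T} = {(v0, g0, T), (v1, g0, T), (v1, g1, T), (v2, g1, T), (v2, g2, T),
      (v3, g2, T), (v3, g3, T), (v4, g3, T), (v4, g4, T), (v0, g4, T)}"
    "r0 (v0, g0, T) = (v1, g0, T)" "r0 (v1, g0, T) = (v0, g0, T)"
    "r0 (v1, g1, T) = (v2, g1, T)" "r0 (v2, g1, T) = (v1, g1, T)"
    "r0 (v2, g2, T) = (v3, g2, T)" "r0 (v3, g2, T) = (v2, g2, T)"
    "r0 (v3, g3, T) = (v4, g3, T)" "r0 (v4, g3, T) = (v3, g3, T)"
    "r0 (v4, g4, T) = (v0, g4, T)" "r0 (v0, g4, T) = (v4, g4, T)"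
    "r1 (v0, g0, T) = (v0, g4, T)" "r1 (v1, g0, T) = (v1, g1, T)"
    "r1 (v1, g1, T) = (v1, g0, T)" "r1 (v2, g1, T) = (v2, g2, T)"
    "r1 (v2, g2, T) = (v2, g1, T)" "r1 (v3, g2, T) = (v3, g3, T)"
    "r1 (v3, g3, T) = (v3, g2, T)" "r1 (v4, g3, T) = (v4, g4, T)"
    "r1 (v4, g4, T) = (v4, g3, T)" "r1 (v0, g4, T) = (v0, g0, T)"
    by (rule pentagon_flags[OF T]) (rule that; assumption)
  have x_in: "x \<in> {(v0, g0, T), (v1, g0, T), (v1, g1, T), (v2, g1, T), (v2, g2, T),
      (v3, g2, T), (v3, g3, T), (v4, g3, T), (v4, g4, T), (v0, g4, T)}"
    unfolding p(3)[symmetric] using assms x by simp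
  have sub: "{(v0, g0, T), (v1, g0, T), (v1, g1, T), (v2, g1, T), (v2, g2, T),
      (v3, g2, T), (v3, g3, T), (v4, g3, T), (v4, g4, T), (v0, g4, T)} \<subseteq> flags"
    unfolding p(3)[symmetric] by blast
  show "r0 (r0 x) = x" "fst (r0 x) \<noteq> fst x" "snd (r0 x) = snd x"
    "r1 (r1 x) = x" "fst (snd (r1 x)) \<noteq> fst (snd x)" "fst (r1 x) = fst x"
    "snd (snd (r1 x)) = snd (snd x)"
    "r0 (r1 (r0 (r1 (r0 (r1 (r0 (r1 (r0 (r1 x))))))))) = x" "r0 x \<in> flags" "r1 x \<in> flags"
    using x_in p(1,2) sub
    by (elim insertE emptyE; simp add: p(4-) del: r0.simps r1.simps; blast)+
  from p(1,2) have d: "v0 \<noteq> v1" "v0 \<noteq> v2" "v0 \<noteq> v3" "v0 \<noteq> v4" "v1 \<noteq> v2" "v1 \<noteq> v3" "v1 \<noteq> v4"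
    "v2 \<noteq> v3" "v2 \<noteq> v4" "v3 \<noteq> v4" "g0 \<noteq> g1" "g0 \<noteq> g2" "g0 \<noteq> g3" "g0 \<noteq> g4" "g1 \<noteq> g2" "g1 \<noteq> g3"
    "g1 \<noteq> g4" "g2 \<noteq> g3" "g2 \<noteq> g4" "g3 \<noteq> g4"
    by simp_all
  note d = d d[symmetric]
  note r = p(4-)
  have unique: "\<forall>y\<in>{x \<in> flags. snd (snd x) = T}.
      (fst (snd y) = fst (snd x) \<longrightarrow> y = x \<or> y = r0 x) \<and> (fst y = fst x \<longrightarrow> y = x \<or> y = r1 x)"
    unfolding p(3) using x_in by (elim insertE emptyE; simp add: r d del: r0.simps r1.simps)
  show "y = x \<or> y = r0 x" if "y \<in> flags" "snd (snd y) = snd (snd x)" "fst (snd y) = fst (snd x)" for y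
    using bspec[OF unique, of y] that by (simp add: x del: r0.simps r1.simps)
  show "y = x \<or> y = r1 x" if "y \<in> flags" "snd (snd y) = snd (snd x)" "fst y = fst x" for y
    using bspec[OF unique, of y] that by (simp add: x del: r0.simps r1.simps)
qed

lemma r2_simps:
  assumes "x \<in> flags"
  shows "r2 x \<in> flags" "r2 (r2 x) = x" "snd (snd (r2 x)) \<noteq> snd (snd x)" "fst (r2 x) = fst x"
    "fst (snd (r2 x)) = fst (snd x)"
    "\<And>y. y \<in> flags \<Longrightarrow> fst y = fst x \<Longrightarrow> fst (snd y) = fst (snd x) \<Longrightarrow> y = x \<or> y = r2 x"
proof -
  obtain u e T where x: "x = (u, e, T)"
    by (cases x)
  then have T: "T \<in> Tl" "e \<in> bd T" "u \<in> ends e"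
    using assms by (auto simp: flags_def)
  then have "card {T \<in> Tl. e \<in> bd T} = 2"
    using bd_E two_tiles by blast
  then obtain A B where AB: "A \<noteq> B" "{T \<in> Tl. e \<in> bd T} = {A, B}"
    unfolding card_2_iff by blast
  moreover have "T \<in> {A, B}"
    using T unfolding AB(2)[symmetric] by simp
  ultimately obtain T' where T': "T' \<noteq> T" and "{T \<in> Tl. e \<in> bd T} = {T, T'}"
    by (metis insertE insert_commute singletonD)
  then have mem: "S \<in> Tl \<and> e \<in> bd S \<longleftrightarrow> S = T \<or> S = T'" for S
    by blast
  have r: "r2 (u, e, T) = (u, e, T')" "r2 (u, e, T') = (u, e, T)"
    using mem T' by (auto intro!: the_equality)
  show "r2 x \<in> flags" "r2 (r2 x) = x" "snd (snd (r2 x)) \<noteq> snd (snd x)" "fst (r2 x) = fst x"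
    "fst (snd (r2 x)) = fst (snd x)"
    using mem[of T'] T' T(3) by (simp_all add: flags_def x r del: r2.simps)
  show "y = x \<or> y = r2 x" if "y \<in> flags" "fst y = fst x" "fst (snd y) = fst (snd x)" for y
    using that mem[of "snd (snd y)"] by (cases y) (simp add: flags_def x r del: r2.simps)
qed

lemma r0_r2_commute: "r0 (r2 x) = r2 (r0 x)"
  by (cases x) simp

section \<open>Labellings by symmetries of the dodecahedron\<close>

definition labelling :: "('v \<times> 'e \<times> 't \<Rightarrow> nat \<Rightarrow> nat) \<Rightarrow> bool" where
  "labelling F \<longleftrightarrow> (\<forall>x\<in>flags. bij (F x) \<and> F (r0 x) = refl0 \<circ> F x \<and> F (r1 x) = refl1 \<circ> F x)"

text \<open>One mismatching flag makes an edge bad; by \<open>consistent_edge\<close> the flags of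
  an edge mismatch all together or not at all.\<close>

definition bad_edges :: "('v \<times> 'e \<times> 't \<Rightarrow> nat \<Rightarrow> nat) \<Rightarrow> 'e set" where
  "bad_edges F = (\<lambda>x. fst (snd x)) ` {x \<in> flags. F (r2 x) \<noteq> refl2 \<circ> F x}"

lemma bij_refl: "bij refl0" "bij refl1" "bij refl2"
  by (auto intro!: o_bij[of refl0 refl0] o_bij[of refl1 refl1] o_bij[of refl2 refl2]
      simp: fun_eq_iff refl_involution)

lemma ex_labelling: "\<exists>F. labelling F"
proof -
  have "\<exists>f :: _ \<Rightarrow> nat \<Rightarrow> nat. \<forall>x\<in>{x \<in> flags. snd (snd x) = T}. bij (f x) \<and> f (r0 x) = refl0 \<circ> f x \<and> f (r1 x) = refl1 \<circ> f x"
    if T: "T \<in> Tl" for T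
  proof -
    obtain v0 v1 v2 v3 v4 g0 g1 g2 g3 g4 where p:
      "distinct [v0, v1, v2, v3, v4]" "distinct [g0, g1, g2, g3, g4]"
      "{x \<in> flags. snd (snd x) = T} = {(v0, g0, T), (v1, g0, T), (v1, g1, T), (v2, g1, T), (v2, g2, T),
        (v3, g2, T), (v3, g3, T), (v4, g3, T), (v4, g4, T), (v0, g4, T)}"
      "r0 (v0, g0, T) = (v1, g0, T)" "r0 (v1, g0, T) = (v0, g0, T)"
      "r0 (v1, g1, T) = (v2, g1, T)" "r0 (v2, g1, T) = (v1, g1, T)"
      "r0 (v2, g2, T) = (v3, g2, T)" "r0 (v3, g2, T) = (v2, g2, T)"
      "r0 (v3, g3, T) = (v4, g3, T)" "r0 (v4, g3, T) = (v3, g3, T)"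
      "r0 (v4, g4, T) = (v0, g4, T)" "r0 (v0, g4, T) = (v4, g4, T)"
      "r1 (v0, g0, T) = (v0, g4, T)" "r1 (v1, g0, T) = (v1, g1, T)"
      "r1 (v1, g1, T) = (v1, g0, T)" "r1 (v2, g1, T) = (v2, g2, T)"
      "r1 (v2, g2, T) = (v2, g1, T)" "r1 (v3, g2, T) = (v3, g3, T)"
      "r1 (v3, g3, T) = (v3, g2, T)" "r1 (v4, g3, T) = (v4, g4, T)"
      "r1 (v4, g4, T) = (v4, g3, T)" "r1 (v0, g4, T) = (v0, g0, T)"
      by (rule pentagon_flags[OF T]) (rule that; assumption)
    note r = p(4-)
    from p(1,2) have d: "v0 \<noteq> v1" "v0 \<noteq> v2" "v0 \<noteq> v3" "v0 \<noteq> v4" "v1 \<noteq> v2" "v1 \<noteq> v3" "v1 \<noteq> v4"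
      "v2 \<noteq> v3" "v2 \<noteq> v4" "v3 \<noteq> v4" "g0 \<noteq> g1" "g0 \<noteq> g2" "g0 \<noteq> g3" "g0 \<noteq> g4" "g1 \<noteq> g2" "g1 \<noteq> g3"
      "g1 \<noteq> g4" "g2 \<noteq> g3" "g2 \<noteq> g4" "g3 \<noteq> g4"
      by simp_all
    note d = d d[symmetric]
    \<comment> \<open>\<open>w\<close> carries the label from one corner to the next. The labels
      close up after a full turn because the fifth power of \<open>w\<close> is the identity, which
      is \<open>refl_face\<close>.\<close>
    define w where "w = refl1 \<circ> refl0"
    define f where "f x = (if x = (v0, g0, T) then id else if x = (v1, g0, T) then refl0
      else if x = (v1, g1, T) then w else if x = (v2, g1, T) then refl0 \<circ> w
      else if x = (v2, g2, T) then w \<circ> w else if x = (v3, g2, T) then refl0 \<circ> (w \<circ> w)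
      else if x = (v3, g3, T) then w \<circ> (w \<circ> w) else if x = (v4, g3, T) then refl0 \<circ> (w \<circ> (w \<circ> w))
      else if x = (v4, g4, T) then w \<circ> (w \<circ> (w \<circ> w)) else refl0 \<circ> (w \<circ> (w \<circ> (w \<circ> w))))" for x
    have "bij (f x)" for x
      by (simp add: f_def w_def bij_comp bij_refl)
    moreover have "f (r0 x) = refl0 \<circ> f x \<and> f (r1 x) = refl1 \<circ> f x" if "x \<in> {x \<in> flags. snd (snd x) = T}" for x
      using that unfolding p(3)
      by (elim insertE emptyE; simp add: r f_def d w_def fun_eq_iff refl_involution refl_face del: r0.simps r1.simps)
    ultimately show ?thesis
      by blast
  qed
  then have "\<forall>T\<in>Tl. \<exists>f :: _ \<Rightarrow> nat \<Rightarrow> nat. \<forall>x\<in>{x \<in> flags. snd (snd x) = T}.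
      bij (f x) \<and> f (r0 x) = refl0 \<circ> f x \<and> f (r1 x) = refl1 \<circ> f x"
    by blast
  from bchoice[OF this] obtain f :: "'t \<Rightarrow> 'v \<times> 'e \<times> 't \<Rightarrow> nat \<Rightarrow> nat" where
    f: "\<forall>T\<in>Tl. \<forall>x\<in>{x \<in> flags. snd (snd x) = T}.
      bij (f T x) \<and> f T (r0 x) = refl0 \<circ> f T x \<and> f T (r1 x) = refl1 \<circ> f T x"
    by blast
  have "labelling (\<lambda>x. f (snd (snd x)) x)"
    unfolding labelling_def
  proof
    fix x assume x: "x \<in> flags"
    then have "snd (snd x) \<in> Tl"
      by (auto simp: flags_def)
    from f[rule_format, OF this] x
    show "bij (f (snd (snd x)) x) \<and> f (snd (snd (r0 x))) (r0 x) = refl0 \<circ> f (snd (snd x)) x \<and>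
        f (snd (snd (r1 x))) (r1 x) = refl1 \<circ> f (snd (snd x)) x"
      by (simp add: r0_r1_simps(4,9))
  qed
  then show ?thesis
    by blast
qed

declare r0.simps [simp del] r1.simps [simp del] r2.simps [simp del]

section \<open>Vertices of degree three\<close>

lemma flags_memD:
  assumes "x \<in> flags"
  shows "snd (snd x) \<in> Tl" "fst (snd x) \<in> bd (snd (snd x))" "fst (snd x) \<in> E" "fst x \<in> ends (fst (snd x))"
  using assms by (auto simp: flags_def dest: subsetD[OF bd_E])

lemma flag_exists:
  assumes "e \<in> E" "u \<in> ends e"
  obtains T where "(u, e, T) \<in> flags"
proof -
  have "card {T \<in> Tl. e \<in> bd T} \<noteq> 0"
    using two_tiles[OF assms(1)] by simp
  then have "{T \<in> Tl. e \<in> bd T} \<noteq> {}"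
    by (metis card.empty)
  then show thesis
    using that assms by (auto simp: flags_def)
qed

text \<open>Turning about a vertex permutes its edges in cycles of length at least two, since
  \<open>r1\<close> changes the edge. Three edges cannot be split into such cycles, so they form a
  single one.\<close>

lemma vertex_three:
  assumes x: "x \<in> flags" and deg: "card {e \<in> E. fst x \<in> ends e} = 3"
  shows "r2 (r1 (r2 (r1 (r2 (r1 x))))) = x" "fst (snd (r1 (r2 (r1 x)))) \<noteq> fst (snd x)"
proof -
  note r = r0_r1_simps(5-9) r2_simps(1-5)
  define y1 y2 y3 y4 y5 where y: "y1 = r1 x" "y2 = r2 y1" "y3 = r1 y2" "y4 = r2 y3" "y5 = r1 y4"
  have yf: "y1 \<in> flags" "y2 \<in> flags" "y3 \<in> flags" "y4 \<in> flags" "y5 \<in> flags"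
    using x by (simp_all add: y r)
  have yv: "fst y1 = fst x" "fst y2 = fst x" "fst y3 = fst x" "fst y4 = fst x" "fst y5 = fst x"
    using x yf by (simp_all add: y r)
  define a b c where "a = fst (snd x)" and "b = fst (snd y1)" and "c = fst (snd y3)"
  have ed: "fst (snd y2) = b" "fst (snd y4) = c" "b \<noteq> a" "c \<noteq> b" "fst (snd y5) \<noteq> c"
    using x yf r unfolding a_def b_def c_def y by metis+
  have flag_a: "z = x \<or> z = r2 x" if "z \<in> flags" "fst z = fst x" "fst (snd z) = a" for z
    using r2_simps(6)[OF x that(1)] that unfolding a_def by simp
  have flag_b: "z = y1 \<or> z = y2" if "z \<in> flags" "fst z = fst x" "fst (snd z) = b" for z
    using r2_simps(6)[OF yf(1) that(1)] that yv unfolding b_def y(2) by simp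
  have r1_y: "r1 y1 = x" "r1 y3 = y2" "r1 y5 = y4"
    using x yf by (simp_all add: y r)
  \<comment> \<open>If \<open>c = a\<close>, the walk closes after two tiles. Then \<open>r1\<close>
    permutes the flags of \<open>a\<close> and \<open>b\<close> at the vertex among themselves, and
    a third edge finds no partner at this vertex in its own tile.\<close>
  have ca: "c \<noteq> a"
  proof
    assume "c = a"
    have y3: "y3 = x \<or> y3 = r2 x"
      using flag_a[OF yf(3) yv(3)] \<open>c = a\<close> c_def by simp
    have "snd (snd y3) = snd (snd y2)" "snd (snd y2) \<noteq> snd (snd y1)" "snd (snd y1) = snd (snd x)"
      using x yf r unfolding y by metis+
    with y3 have y3: "y3 = r2 x"
      by metis
    have "{e \<in> E. fst x \<in> ends e} \<noteq> {a, b}"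
      using deg \<open>b \<noteq> a\<close> by (metis card_2_iff numeral_eq_iff semiring_norm(89))
    moreover have "a \<in> {e \<in> E. fst x \<in> ends e}" "b \<in> {e \<in> E. fst x \<in> ends e}"
      using flags_memD[OF x] flags_memD[OF yf(1)] yv by (auto simp: a_def b_def)
    ultimately obtain d where d: "d \<in> E" "fst x \<in> ends d" "d \<noteq> a" "d \<noteq> b"
      by blast
    then obtain T where z: "(fst x, d, T) \<in> flags"
      by (meson flag_exists)
    define z' where "z' = r1 (fst x, d, T)"
    have z': "z' \<in> flags" "fst z' = fst x" "r1 z' = (fst x, d, T)" "fst (snd z') \<noteq> d"
      using z r unfolding z'_def by (metis fst_conv snd_conv)+
    have "fst (snd z') \<in> {a, b}"
    proof (rule ccontr)
      assume n: "fst (snd z') \<notin> {a, b}"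
      have "{a, b, d, fst (snd z')} \<subseteq> {e \<in> E. fst x \<in> ends e}"
        using d flags_memD[OF z'(1)] z'(2) \<open>a \<in> _\<close> \<open>b \<in> _\<close> by auto
      moreover have "finite {e \<in> E. fst x \<in> ends e}"
        using finite_E by simp
      ultimately have "card {a, b, d, fst (snd z')} \<le> 3"
        using deg card_mono by metis
      moreover have "card {a, b, d, fst (snd z')} = 4"
        using n d z'(4) ed(3) by auto
      ultimately show False
        by simp
    qed
    then have "z' \<in> {x, r2 x, y1, y2}"
      using flag_a flag_b z'(1,2) by blast
    then have "(fst x, d, T) \<in> {y1, y2, y3, x}"
      using z'(3) r1_y y3 y(1,3) by (metis empty_iff insert_iff)
    then have "d \<in> {a, b}"
      using \<open>c = a\<close> ed(1) unfolding a_def b_def c_def by (metis empty_iff fst_conv insert_iff snd_conv)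
    then show False
      using d by simp
  qed
  then show "fst (snd (r1 (r2 (r1 x)))) \<noteq> fst (snd x)"
    unfolding a_def c_def y .
  have sub: "{a, b, c} \<subseteq> {e \<in> E. fst x \<in> ends e}"
    using flags_memD[OF x] flags_memD[OF yf(1)] flags_memD[OF yf(3)] yv by (auto simp: a_def b_def c_def)
  have edges: "{e \<in> E. fst x \<in> ends e} = {a, b, c}"
    by (rule card_subset_eq[symmetric, OF _ sub]) (use finite_E deg ca ed(3,4) in auto)
  have "fst (snd y5) \<in> {e \<in> E. fst x \<in> ends e}"
    using flags_memD[OF yf(5)] yv by auto
  then have "fst (snd y5) = a \<or> fst (snd y5) = b"
    using edges ed(5) by auto
  moreover have "fst (snd y5) \<noteq> b"
  proof
    assume "fst (snd y5) = b"
    then have "y5 = y1 \<or> y5 = y2"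
      using flag_b yf(5) yv(5) by blast
    then have "y4 = x \<or> y4 = y3"
      using r1_y(1,3) y(3) by auto
    then show False
      using ca ed(2) a_def r2_simps(3)[OF yf(3)] y(4) by metis
  qed
  ultimately have "y5 = x \<or> y5 = r2 x"
    using flag_a yf(5) yv(5) by blast
  moreover have "y5 \<noteq> x"
    using r1_y(3) y(1) ed(2,4) b_def by auto
  ultimately have "r2 y5 = x"
    using r2_simps(2)[OF x] by metis
  then show "r2 (r1 (r2 (r1 (r2 (r1 x))))) = x"
    by (simp add: y)
qed

text \<open>The four flags of an edge are linked by \<open>r0\<close> and \<open>r2\<close>. A match
  passes along \<open>r0\<close> because \<open>refl0\<close> and \<open>refl2\<close> commute, and
  along \<open>r2\<close> because \<open>refl2\<close> is an involution.\<close>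

lemma consistent_edge:
  assumes F: "labelling F" and x: "x \<in> flags" "F (r2 x) = refl2 \<circ> F x"
    and y: "y \<in> flags" "fst (snd y) = fst (snd x)"
  shows "F (r2 y) = refl2 \<circ> F y"
proof -
  have step0: "F (r2 (r0 z)) = refl2 \<circ> F (r0 z)" if "z \<in> flags" "F (r2 z) = refl2 \<circ> F z" for z
  proof -
    have "F (r0 (r2 z)) = refl0 \<circ> F (r2 z)" "F (r0 z) = refl0 \<circ> F z"
      using F that r2_simps(1) unfolding labelling_def by blast+
    then show ?thesis
      by (simp add: r0_r2_commute[symmetric] that(2) fun_eq_iff refl_commute)
  qed
  have step2: "F (r2 (r2 x)) = refl2 \<circ> F (r2 x)"
    using x r2_simps(2)[OF x(1)] by (simp add: fun_eq_iff refl_involution)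
  define z where "z = (fst x, fst (snd x), snd (snd y))"
  have "z \<in> flags"
    using x y unfolding z_def flags_def by auto
  then have z: "z = x \<or> z = r2 x"
    using r2_simps(6)[OF x(1), of z] unfolding z_def by simp
  have "y = z \<or> y = r0 z"
    using r0_r1_unique(1)[OF \<open>z \<in> flags\<close> y(1)] y(2) unfolding z_def by simp
  then show ?thesis
    using z step0[OF x] step0[OF r2_simps(1)[OF x(1)] step2] x(2) step2 by blast
qed

lemma not_one_bad_edge:
  assumes F: "labelling F" and deg: "card {e \<in> E. u \<in> ends e} = 3"
  shows "card {e \<in> bad_edges F. u \<in> ends e} \<noteq> 1"
proof
  assume "card {e \<in> bad_edges F. u \<in> ends e} = 1"
  then obtain a where "{e \<in> bad_edges F. u \<in> ends e} = {a}"
    by (meson card_1_singletonE)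
  then have a: "e \<in> bad_edges F \<and> u \<in> ends e \<longleftrightarrow> e = a" for e
    by (simp add: set_eq_iff)
  have "a \<in> bad_edges F"
    using a[of a] by simp
  then obtain z where z: "z \<in> flags" "F (r2 z) \<noteq> refl2 \<circ> F z" "fst (snd z) = a"
    unfolding bad_edges_def by blast
  define x where "x = (u, a, snd (snd z))"
  have x: "x \<in> flags"
    using flags_memD[OF z(1)] z(3) a[of a] by (simp add: x_def flags_def)
  have bad: "F (r2 x) \<noteq> refl2 \<circ> F x"
  proof
    assume "F (r2 x) = refl2 \<circ> F x"
    then have "F (r2 z) = refl2 \<circ> F z"
      by (rule consistent_edge[OF F x _ z(1)]) (simp add: x_def z(3))
    then show False
      using z(2) by simp
  qed
  define y1 y2 y3 y4 y5 where y: "y1 = r1 x" "y2 = r2 y1" "y3 = r1 y2" "y4 = r2 y3" "y5 = r1 y4"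
  have yf: "y1 \<in> flags" "y2 \<in> flags" "y3 \<in> flags" "y4 \<in> flags"
    using x by (simp_all add: y r0_r1_simps r2_simps)
  have yv: "fst y1 = u" "fst y3 = u"
    using x yf by (simp_all add: y r0_r1_simps r2_simps x_def del: r1.simps r2.simps)
  have "fst x = u" "fst (snd x) = a"
    by (simp_all add: x_def)
  with vertex_three[OF x] deg have cyc: "r2 y5 = x" and "fst (snd y3) \<noteq> a"
    by (simp_all add: y)
  moreover have "fst (snd y1) \<noteq> a"
    using r0_r1_simps(7)[OF x] \<open>fst (snd x) = a\<close> y(1) by simp
  ultimately have "fst (snd y1) \<notin> bad_edges F" "fst (snd y3) \<notin> bad_edges F"
    using a flags_memD(4)[OF yf(1)] flags_memD(4)[OF yf(3)] yv by metis+
  then have "F y2 = refl2 \<circ> F y1" "F y4 = refl2 \<circ> F y3"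
    using yf unfolding bad_edges_def y by blast+
  moreover have "F y1 = refl1 \<circ> F x" "F y3 = refl1 \<circ> F y2" "F y5 = refl1 \<circ> F y4"
    using F x yf unfolding labelling_def y by blast+
  moreover have "y5 = r2 x"
    using cyc r2_simps(2) y(5) r0_r1_simps(5)[OF yf(4)] by metis
  \<comment> \<open>On the long way around the vertex from \<open>x\<close> to \<open>r2 x\<close>,
    with the two other edges matching, the label is multiplied by this product. As it equals
    \<open>refl2\<close>, the edge of \<open>x\<close> matches as well.\<close>
  moreover have "refl1 (refl2 (refl1 (refl2 (refl1 n)))) = refl2 n" for n
    using refl_vertex[of "refl2 n"] by (simp add: refl_involution)
  ultimately show False
    using bad by (simp add: fun_eq_iff)
qed

section \<open>Relabelling one side of a cut\<close>

definition cut_edges :: "'t set \<Rightarrow> 'e set" where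
  "cut_edges X = {e \<in> E. \<exists>T\<in>X. \<exists>T'\<in>Tl - X. e \<in> bd T \<and> e \<in> bd T'}"

text \<open>The reflections act from the left, so composing the labels on \<open>X\<close> with one
  bijection from the right preserves \<open>labelling\<close> and every match at an edge outside the
  cut. The edges of the cut were bad before, so nothing is lost there, and the bijection is chosen
  to repair one of them.\<close>

lemma relabel:
  assumes F: "labelling F" and X: "X \<subseteq> Tl" "cut_edges X \<noteq> {}" "cut_edges X \<subseteq> bad_edges F"
  obtains F' where "labelling F'" "bad_edges F' \<subset> bad_edges F"
proof -
  obtain e T T' where e: "e \<in> E" "e \<in> bd T" "e \<in> bd T'" "T \<in> X" "T' \<in> Tl - X"
    using X(2) unfolding cut_edges_def by blast
  have "T \<in> Tl"
    using e(4) X(1) by blast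
  have "ends e \<noteq> {}"
    using pentagon[OF \<open>T \<in> Tl\<close>] e(2) by (elim exE conjE) auto
  then obtain u where "u \<in> ends e"
    by blast
  define x where "x = (u, e, T)"
  have x: "x \<in> flags" and x': "(u, e, T') \<in> flags"
    using e X(1) \<open>u \<in> ends e\<close> by (auto simp: x_def flags_def)
  then have r2x: "r2 x = (u, e, T')"
    using r2_simps(6)[OF x x'] e by (auto simp: x_def)
  \<comment> \<open>The solution of \<open>F x \<circ> h = refl2 \<circ> F (r2 x)\<close>, which
    makes the edge \<open>e\<close> match.\<close>
  define h where "h = inv (F x) \<circ> (refl2 \<circ> F (r2 x))"
  define F' where "F' y = (if snd (snd y) \<in> X then F y \<circ> h else F y)" for y
  have bijF: "bij (F y)" if "y \<in> flags" for y
    using F that unfolding labelling_def by blast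
  have "bij h"
    unfolding h_def by (intro bij_comp bij_refl bijF bij_imp_bij_inv x r2_simps(1))
  then have F': "labelling F'"
    using F r0_r1_simps(4,9) by (auto simp: labelling_def F'_def bij_comp comp_assoc)
  have Fx: "F x \<circ> h = refl2 \<circ> F (r2 x)"
    using bij_is_surj[OF bijF[OF x]] by (simp add: h_def fun_eq_iff surj_f_inv_f)
  have "F' (r2 x) = refl2 \<circ> F' x"
  proof -
    have "F' x = F x \<circ> h" "F' (r2 x) = F (r2 x)"
      unfolding F'_def r2x using e by (simp_all add: x_def)
    then show ?thesis
      by (simp add: Fx fun_eq_iff refl_involution)
  qed
  then have "e \<notin> bad_edges F'"
    using consistent_edge[OF F' x] by (auto simp: bad_edges_def x_def)
  moreover have "f \<in> bad_edges F" if f: "f \<in> bad_edges F'" for f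
  proof (rule ccontr)
    assume nf: "f \<notin> bad_edges F"
    obtain y where y: "y \<in> flags" "F' (r2 y) \<noteq> refl2 \<circ> F' y" "fst (snd y) = f"
      using f unfolding bad_edges_def by blast
    have eq: "F (r2 y) = refl2 \<circ> F y"
      using nf y unfolding bad_edges_def by blast
    have ncut: "f \<notin> cut_edges X"
      using nf X(3) by blast
    have r2y: "snd (snd (r2 y)) \<in> Tl" "f \<in> bd (snd (snd (r2 y)))" "f \<in> E"
      using flags_memD[OF r2_simps(1)[OF y(1)]] r2_simps(5)[OF y(1)] y(3) by auto
    have "snd (snd (r2 y)) \<in> X \<longleftrightarrow> snd (snd y) \<in> X"
      using ncut r2y flags_memD[OF y(1)] y(3) unfolding cut_edges_def by blast
    then show False
      using eq y(2) by (auto simp: F'_def comp_assoc)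
  qed
  moreover have "e \<in> bad_edges F"
    using e X(3) unfolding cut_edges_def by blast
  ultimately show thesis
    using that F' by blast
qed

text \<open>The topology enters through two assumptions: \<open>separation\<close> is what the
  Jordan curve theorem yields for a cycle of edges, and \<open>link\<close> says that the edges at
  \<open>v\<close> are connected through common tiles.\<close>

theorem exceptional_vertex_contradiction:
  assumes deg: "\<And>e u. e \<in> E \<Longrightarrow> u \<in> ends e \<Longrightarrow> u \<noteq> v \<Longrightarrow> card {e \<in> E. u \<in> ends e} = 3"
    and deg_v: "card {e \<in> E. v \<in> ends e} > 3"
    and separation: "\<And>M. M \<subseteq> E \<Longrightarrow> M \<noteq> {} \<Longrightarrow> (\<And>u. u \<noteq> v \<Longrightarrow> card {e \<in> M. u \<in> ends e} \<noteq> 1) \<Longrightarrow>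
      \<exists>X\<subseteq>Tl. cut_edges X \<noteq> {} \<and> cut_edges X \<subseteq> M"
    and link: "\<And>C. C \<subseteq> {e \<in> E. v \<in> ends e} \<Longrightarrow> C \<noteq> {} \<Longrightarrow>
      (\<And>T e e'. T \<in> Tl \<Longrightarrow> e \<in> bd T \<Longrightarrow> e' \<in> bd T \<Longrightarrow> v \<in> ends e \<Longrightarrow> v \<in> ends e' \<Longrightarrow> e \<in> C \<Longrightarrow> e' \<in> C) \<Longrightarrow>
      C = {e \<in> E. v \<in> ends e}"
  shows False
proof -
  obtain F0 where "labelling F0"
    using ex_labelling by blast
  then obtain F where F: "labelling F" and least: "\<And>G. labelling G \<Longrightarrow> card (bad_edges F) \<le> card (bad_edges G)"
    using ex_has_least_nat[of labelling F0 "\<lambda>F. card (bad_edges F)"] by blast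
  have sub: "bad_edges F \<subseteq> E"
    using flags_memD(3) by (auto simp: bad_edges_def)
  have "bad_edges F = {}"
  proof (rule ccontr)
    assume ne: "bad_edges F \<noteq> {}"
    have "card {e \<in> bad_edges F. u \<in> ends e} \<noteq> 1" if "u \<noteq> v" for u
    proof (cases "\<exists>e\<in>E. u \<in> ends e")
      case True
      then show ?thesis
        using not_one_bad_edge[OF F] deg that by blast
    next
      case False
      then have "{e \<in> bad_edges F. u \<in> ends e} = {}"
        using sub by blast
      then show ?thesis
        by (metis card.empty zero_neq_one)
    qed
    from separation[OF sub ne this] obtain X where
      "X \<subseteq> Tl" "cut_edges X \<noteq> {}" "cut_edges X \<subseteq> bad_edges F"
      by blast
    then obtain F' where "labelling F'" "bad_edges F' \<subset> bad_edges F"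
      using relabel[OF F] by blast
    then show False
      using least finite_subset[OF sub finite_E] psubset_card_mono by (metis not_le)
  qed
  then have F2: "F (r2 x) = refl2 \<circ> F x" if "x \<in> flags" for x
    using that unfolding bad_edges_def by blast
  have F01: "F (r0 x) = refl0 \<circ> F x" "F (r1 x) = refl1 \<circ> F x" "bij (F x)" if "x \<in> flags" for x
    using that F unfolding labelling_def by blast+
  have "{e \<in> E. v \<in> ends e} \<noteq> {}"
    using deg_v by (metis card.empty not_less_zero)
  then obtain e0 where e0: "e0 \<in> E" "v \<in> ends e0"
    by blast
  then obtain T0 where "(v, e0, T0) \<in> flags"
    by (meson flag_exists)
  define x0 where "x0 = (v, e0, T0)"
  have x0: "x0 \<in> flags" "fst x0 = v" "fst (snd x0) = e0"
    using \<open>(v, e0, T0) \<in> flags\<close> by (simp_all add: x0_def)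
  \<comment> \<open>The vertex of a flag \<open>x\<close> is sent to \<open>inv (F x) 0\<close>.
    Hence \<open>c x\<close> is the image of the initial vertex in the frame of \<open>x\<close>,
    and it is \<open>0\<close> exactly when the vertices of \<open>x\<close> and \<open>x0\<close>
    have the same image.\<close>
  define c where "c x = F x (inv (F x0) 0)" for x
  have c: "c (r0 x) = refl0 (c x)" "c (r1 x) = refl1 (c x)" "c (r2 x) = refl2 (c x)" if "x \<in> flags" for x
    using that F01 F2 by (simp_all add: c_def)
  have c0: "c x0 = 0"
    using bij_is_surj[OF F01(3)[OF x0(1)]] by (simp add: c_def surj_f_inv_f)
  have fix0: "refl1 0 = 0" "refl2 0 = 0"
    by (simp_all add: refl_values)
  \<comment> \<open>\<open>refl1\<close> and \<open>refl2\<close> fix \<open>0\<close>, so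
    \<open>c\<close> stays \<open>0\<close> while a flag turns about \<open>v\<close>; by
    \<open>link\<close> this reaches every flag at \<open>v\<close>. Flags with
    \<open>c x \<noteq> 0\<close> therefore have a vertex of degree three.\<close>
  define C where "C = {e \<in> E. v \<in> ends e \<and> (\<forall>x\<in>flags. fst x = v \<longrightarrow> fst (snd x) = e \<longrightarrow> c x = 0)}"
  have "C = {e \<in> E. v \<in> ends e}"
  proof (rule link)
    have "c x = 0" if "x \<in> flags" "fst x = v" "fst (snd x) = e0" for x
      using r2_simps(6)[OF x0(1) that(1)] that x0 c0 c(3)[OF x0(1)] fix0 by auto
    then show "C \<noteq> {}"
      using e0 unfolding C_def by blast
  next
    fix T e e' assume T: "T \<in> Tl" "e \<in> bd T" "e' \<in> bd T" "v \<in> ends e" "v \<in> ends e'" "e \<in> C"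
    define y y' where "y = (v, e, T)" and "y' = (v, e', T)"
    have y: "y \<in> flags" "y' \<in> flags"
      using T by (auto simp: y_def y'_def flags_def)
    then have "c y = 0"
      using T(6) unfolding C_def y_def by auto
    moreover have "y' = y \<or> y' = r1 y"
      using r0_r1_unique(2)[OF y] by (simp add: y_def y'_def)
    ultimately have y'0: "c y' = 0"
      using c(2)[OF y(1)] fix0 by auto
    have "c x = 0" if "x \<in> flags" "fst x = v" "fst (snd x) = e'" for x
      using r2_simps(6)[OF y(2) that(1)] that y'0 c(3)[OF y(2)] fix0 by (auto simp: y'_def simp del: r2.simps)
    then show "e' \<in> C"
      using T bd_E unfolding C_def by blast
  qed (auto simp: C_def)
  then have cv: "c x = 0" if "x \<in> flags" "fst x = v" for x
    using that flags_memD[OF that(1)] unfolding C_def by blast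
  note r = r0_r1_simps r2_simps(1-5)
  \<comment> \<open>The fourth power of the rotation is its inverse, since the fifth is the
    identity.\<close>
  have P4: "((\<lambda>x. r0 (r1 x)) ^^ 4) x = r1 (r0 x)" if "x \<in> flags" for x
    using r0_r1_simps(10)[of "r1 (r0 x)"] that by (simp add: funpow_small r)
  have "r0 (r2 (((\<lambda>x. r0 (r1 x)) ^^ 4) (r0 (r2 (((\<lambda>x. r0 (r1 x)) ^^ 4) (r0 (r2 x0))))))) = r0 (r1 x0)"
  proof (rule dodecahedron_develop[of x0 flags c "\<lambda>x. r0 (r1 x)" "\<lambda>x. r0 (r2 x)"])
    fix x assume x: "x \<in> flags"
    show "((\<lambda>x. r0 (r1 x)) ^^ 5) x = x"
      using r0_r1_simps(10)[OF x] by (simp add: eval_nat_numeral)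
    show "r0 (r2 (r0 (r2 x))) = x"
      using x by (simp add: r0_r2_commute r)
    assume "c x \<noteq> 0"
    then have "fst x \<noteq> v"
      using cv[OF x] by auto
    then have "card {e \<in> E. fst x \<in> ends e} = 3"
      by (rule deg[OF flags_memD(3,4)[OF x]])
    then have "r2 (r1 (r2 (r1 (r2 x)))) = r1 x"
      using vertex_three(1)[of "r1 x"] x by (simp add: r)
    then show "r0 (r2 (((\<lambda>x. r0 (r1 x)) ^^ 4) (r0 (r2 (((\<lambda>x. r0 (r1 x)) ^^ 4) (r0 (r2 x))))))) = r0 (r1 x)"
      using x by (simp add: P4 r)
  qed (use x0 c0 c r in simp_all)
  then have "r0 (r2 (r1 (r2 (r1 (r2 x0))))) = r0 (r1 x0)"
    using x0 by (simp add: P4 r)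
  from arg_cong[OF this, of r0] have "r2 (r1 (r2 (r1 (r2 x0)))) = r1 x0"
    using x0(1) by (simp add: r)
  then have cyc: "r1 (r2 (r1 (r2 (r1 x0)))) = r2 x0"
    using x0(1) by (simp add: r flip: \<open>r2 (r1 (r2 (r1 (r2 x0)))) = r1 x0\<close>)
  define y1 y2 y3 y4 where y: "y1 = r1 x0" "y2 = r2 y1" "y3 = r1 y2" "y4 = r2 y3"
  have yf: "y1 \<in> flags" "y2 \<in> flags" "y3 \<in> flags" "y4 \<in> flags" "r2 x0 \<in> flags"
    using x0 by (simp_all add: y r)
  have yv: "fst y1 = v" "fst y2 = v" "fst y3 = v" "fst y4 = v" "fst (r2 x0) = v"
    using x0 yf by (simp_all add: y r)
  have r1y: "r1 y1 = x0" "r1 y2 = y3" "r1 y3 = y2" "r1 y4 = r2 x0" "r1 x0 = y1"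
    using r0_r1_simps(6)[OF x0(1)] r0_r1_simps(6)[OF yf(2)] cyc by (simp_all add: y)
  then have r1y': "r1 (r2 x0) = y4"
    using r0_r1_simps(6)[OF yf(4)] by simp
  \<comment> \<open>The walk from \<open>x0\<close> around \<open>v\<close> closes after three
    tiles. The six flags on it are closed under \<open>r1\<close> and \<open>r2\<close>, so by
    \<open>link\<close> the edges in \<open>K\<close> are all the edges at \<open>v\<close>.\<close>
  define K where "K = {fst (snd x0), fst (snd y1), fst (snd y3)}"
  have Kf: "z \<in> {x0, r2 x0, y1, y2, y3, y4}" if z: "z \<in> flags" "fst z = v" "fst (snd z) \<in> K" for z
  proof -
    have "fst (snd z) = fst (snd x0) \<Longrightarrow> z = x0 \<or> z = r2 x0"
      "fst (snd z) = fst (snd y1) \<Longrightarrow> z = y1 \<or> z = y2" "fst (snd z) = fst (snd y3) \<Longrightarrow> z = y3 \<or> z = y4"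
      using r2_simps(6)[OF x0(1) z(1)] r2_simps(6)[OF yf(1) z(1), folded y(2)]
        r2_simps(6)[OF yf(3) z(1), folded y(4)] z(2) yv x0(2) by simp_all
    then show ?thesis
      using z(3) unfolding K_def by blast
  qed
  have edK: "fst (snd z) \<in> K" if "z \<in> {x0, r2 x0, y1, y2, y3, y4}" for z
    using that r2_simps(5)[OF x0(1)] r2_simps(5)[OF yf(1), folded y(2)] r2_simps(5)[OF yf(3), folded y(4)]
    unfolding K_def by auto
  have "K = {e \<in> E. v \<in> ends e}"
  proof (rule link)
    show "K \<subseteq> {e \<in> E. v \<in> ends e}"
      using flags_memD[OF x0(1)] flags_memD[OF yf(1)] flags_memD[OF yf(3)] x0(2) yv unfolding K_def by auto
    show "K \<noteq> {}"
      by (simp add: K_def)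
    fix T e e' assume T: "T \<in> Tl" "e \<in> bd T" "e' \<in> bd T" "v \<in> ends e" "v \<in> ends e'" "e \<in> K"
    define z z' where "z = (v, e, T)" and "z' = (v, e', T)"
    have z: "z \<in> flags" "z' \<in> flags"
      using T by (auto simp: z_def z'_def flags_def)
    have z_in: "z \<in> {x0, r2 x0, y1, y2, y3, y4}"
      using Kf[OF z(1)] T(6) by (simp add: z_def)
    have "r1 z \<in> {x0, r2 x0, y1, y2, y3, y4}"
      using r1y r1y' z_in by auto
    moreover have "z' = z \<or> z' = r1 z"
      using r0_r1_unique(2)[OF z] by (simp add: z_def z'_def)
    ultimately have "z' \<in> {x0, r2 x0, y1, y2, y3, y4}"
      using z_in by auto
    then show "e' \<in> K"
      using edK[of z'] by (simp add: z'_def)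
  qed
  moreover have "card K \<le> 3"
    unfolding K_def by (simp add: card_insert_if)
  ultimately show False
    using deg_v by simp
qed

end

section \<open>Jordan curves on the sphere\<close>

text \<open>Cutting the curve near the point by a small arc makes its intersection with the complement of
  the neighbourhood connected, so Janiszewski's theorem applies.\<close>

lemma Jordan_local_start:
  fixes c :: "real \<Rightarrow> complex"
  assumes c: "simple_path c" "pathfinish c = pathstart c" and W: "open W" "pathstart c \<in> W"
  obtains N where "open N" "pathstart c \<in> N" "N \<subseteq> W"
    "\<And>x y. x \<in> N \<Longrightarrow> y \<in> N \<Longrightarrow> connected_component (- path_image c) x y \<Longrightarrow>
      connected_component (W - path_image c) x y"
proof -
  have cont: "continuous_on {0..1} c"
    using c(1) by (simp add: simple_path_def path_def)
  then obtain V where V: "open V" "V \<inter> {0..1} = c -` W \<inter> {0..1}"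
    using W(1) by (metis continuous_on_open_invariant)
  have "0 \<in> c -` W \<inter> {0..1}" "1 \<in> c -` W \<inter> {0..1}"
    using W(2) c(2) by (simp_all add: pathstart_def pathfinish_def)
  then have "0 \<in> V" "1 \<in> V"
    unfolding V(2)[symmetric] by simp_all
  then obtain d1 d2 where d: "d1 > 0" "ball 0 d1 \<subseteq> V" "d2 > 0" "ball 1 d2 \<subseteq> V"
    using V(1) by (meson open_contains_ball)
  \<comment> \<open>Halving keeps both end pieces of the curve within the balls that are mapped into
    \<open>W\<close>; the bound \<open>1/3\<close> makes \<open>{d..1-d}\<close> a genuine
    interval.\<close>
  define d where "d = min (1/3) (min (d1/2) (d2/2))"
  have d0: "0 < d" "d < 1/2" "d < d1" "d < d2"
    using d by (auto simp: d_def)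
  have near: "c t \<in> W" if "t \<in> {0..1}" "t \<notin> {d..1-d}" for t
  proof -
    have "t \<in> V"
      using that d d0 by (cases "t < d") (auto simp: dist_real_def subset_iff)
    then show ?thesis
      using V(2) that by auto
  qed
  define r where "r = c ` {d..1-d}"
  have sub: "{d..1-d} \<subseteq> {0..1}"
    using d0 by auto
  have "continuous_on {d..1-d} c"
    by (rule continuous_on_subset[OF cont sub])
  then have r: "compact r" "connected r" "r \<subseteq> path_image c"
    unfolding r_def path_image_def using image_mono[OF sub, of c]
    by (blast intro: compact_continuous_image[OF _ compact_Icc] connected_continuous_image[OF _ connected_Icc])+
  have "pathstart c \<notin> r"
  proof
    assume "pathstart c \<in> r"
    then obtain t where "t \<in> {d..1-d}" "c 0 = c t"
      by (auto simp: r_def pathstart_def)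
    then show False
      using c(1) d0 unfolding simple_path_def loop_free_def by fastforce
  qed
  moreover have "closed r"
    using r(1) compact_imp_closed by blast
  ultimately obtain e where e: "e > 0" "ball (pathstart c) e \<subseteq> W - r"
    using W by (metis DiffI open_Diff open_contains_ball)
  have cut: "path_image c \<inter> (- W \<union> r) = r"
  proof -
    have "c t \<in> r" if "t \<in> {0..1}" "c t \<notin> W" for t
      using near that unfolding r_def by blast
    then show ?thesis
      using r(3) unfolding path_image_def by blast
  qed
  show thesis
  proof (rule that)
    show "open (ball (pathstart c) e)" "pathstart c \<in> ball (pathstart c) e" "ball (pathstart c) e \<subseteq> W"
      using e by auto
    fix x y assume xy: "x \<in> ball (pathstart c) e" "y \<in> ball (pathstart c) e"
      "connected_component (- path_image c) x y"
    \<comment> \<open>The ball lies in \<open>W\<close> and misses \<open>r\<close>, so it joins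
      \<open>x\<close> and \<open>y\<close> off \<open>- W \<union> r\<close>; off the curve they
      are joined by assumption. The two closed sets meet in the connected set \<open>r\<close>, so
      the points are joined off both at once.\<close>
    have "connected_component (- (- W \<union> r)) x y"
      unfolding connected_component_def
      by (rule exI[of _ "ball (pathstart c) e"]) (use xy e in auto)
    moreover have "compact (path_image c)" "closed (- W \<union> r)"
      using c W \<open>closed r\<close> by (auto simp: compact_simple_path_image)
    ultimately have "connected_component (- (path_image c \<union> (- W \<union> r))) x y"
      using Janiszewski[of "path_image c" "- W \<union> r" x y] cut r(2) xy(3) by simp
    then show "connected_component (W - path_image c) x y"
      by (rule connected_component_of_subset) auto
  qed
qed

lemma Jordan_local:
  fixes c :: "real \<Rightarrow> complex"
  assumes c: "simple_path c" "pathfinish c = pathstart c" and W: "open W" "p \<in> W"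
    and p: "p \<in> path_image c"
  obtains N where "open N" "p \<in> N" "N \<subseteq> W"
    "\<And>x y. x \<in> N \<Longrightarrow> y \<in> N \<Longrightarrow> connected_component (- path_image c) x y \<Longrightarrow>
      connected_component (W - path_image c) x y"
proof -
  obtain a where a: "a \<in> {0..1}" "p = c a"
    using p by (auto simp: path_image_def)
  have "simple_path (shiftpath a c)" "pathfinish (shiftpath a c) = pathstart (shiftpath a c)"
    "pathstart (shiftpath a c) = p" "path_image (shiftpath a c) = path_image c"
    using a c by (auto simp: simple_path_shiftpath path_image_shiftpath pathstart_shiftpath closed_shiftpath)
  then show thesis
    using Jordan_local_start[of "shiftpath a c" W] W(2) that W(1) by auto
qed

text \<open>Stereographic projection. The target is \<open>complex\<close> because the planar
  separation theorems used here concern \<open>complex\<close>.\<close>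

lemma sphere_minus_point_homeomorphism:
  assumes "q \<in> S2"
  obtains h :: "real^3 \<Rightarrow> complex" and k where "homeomorphism (S2 - {q}) UNIV h k"
proof -
  define c :: "real^3" where "c = axis 1 1"
  have "c \<noteq> 0"
    by (simp add: c_def axis_eq_0_iff)
  have "S2 - {q} homeomorphic {x. c \<bullet> x = 0}"
    using assms \<open>c \<noteq> 0\<close> by (intro homeomorphic_punctured_sphere_hyperplane) auto
  also have "{x. c \<bullet> x = 0} homeomorphic (UNIV :: complex set)"
    by (subst homeomorphic_affine_sets_eq) (use \<open>c \<noteq> 0\<close> in \<open>auto simp: affine_hyperplane aff_dim_hyperplane\<close>)
  finally show thesis
    using that unfolding homeomorphic_def by blast
qed

lemma openin_sphere_image:
  assumes h: "homeomorphism (S2 - {q}) (UNIV :: complex set) h k" and "open U"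
  shows "openin (top_of_set S2) (k ` U)"
proof -
  have "openin (top_of_set (S2 - {q})) (k ` U)"
    using homeomorphism_imp_open_map[OF homeomorphism_symD[OF h], of U] assms(2) by simp
  moreover have "openin (top_of_set S2) (S2 - {q})"
    by (simp add: openin_delete)
  ultimately show ?thesis
    using openin_trans by blast
qed

lemma open_plane_image:
  assumes h: "homeomorphism (S2 - {q}) (UNIV :: complex set) h k" and W: "openin (top_of_set S2) W"
  shows "open (h ` (W - {q}))"
proof -
  have "openin (top_of_set (S2 - {q})) (W - {q})"
    using W by (auto simp: openin_open)
  then show ?thesis
    using homeomorphism_imp_open_map[OF h] by simp
qed

lemma connected_component_image:
  assumes "connected_component S x y" "continuous_on S k" "k ` S \<subseteq> T"
  shows "connected_component T (k x) (k y)"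
proof -
  obtain C where "connected C" "C \<subseteq> S" "x \<in> C" "y \<in> C"
    using assms(1) unfolding connected_component_def by blast
  then show ?thesis
    unfolding connected_component_def
    by (intro exI[of _ "k ` C"]) (use assms in \<open>auto intro: connected_continuous_image continuous_on_subset\<close>)
qed

lemma sphere_antipode:
  assumes "p \<in> S2"
  shows "- p \<in> S2" "- p \<noteq> p"
proof -
  show "- p \<in> S2"
    using assms by simp
  show "- p \<noteq> p"
  proof
    assume "- p = p"
    then have "2 *\<^sub>R p = 0"
      by (simp add: scaleR_2 flip: eq_neg_iff_add_eq_0)
    then show False
      using assms by simp
  qed
qed

text \<open>In the chart punctured at the antipode this is a disc, which stays connected without its
  centre. It serves twice: an edge cannot fill a neighbourhood of one of its points, and the link of
  a vertex is connected.\<close>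

lemma sphere_punctured_neighbourhood:
  assumes "p \<in> S2" "openin (top_of_set S2) W" "p \<in> W"
  obtains N where "openin (top_of_set S2) N" "p \<in> N" "N \<subseteq> W" "connected (N - {p})"
proof -
  note sphere_antipode[OF assms(1)]
  then obtain h :: "real^3 \<Rightarrow> complex" and k where h: "homeomorphism (S2 - {- p}) UNIV h k"
    using sphere_minus_point_homeomorphism by blast
  have hk: "k (h x) = x" if "x \<in> S2" "x \<noteq> - p" for x
    using h that by (auto simp: homeomorphism_def)
  have kh: "h (k z) = z" for z
    using h by (auto simp: homeomorphism_def)
  have "h p \<in> h ` (W - {- p})"
    using assms(3) \<open>- p \<noteq> p\<close> by simp
  then obtain e where e: "e > 0" "ball (h p) e \<subseteq> h ` (W - {- p})"
    using open_plane_image[OF h assms(2)] by (meson open_contains_ball)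
  have WS: "W \<subseteq> S2"
    using assms(2) openin_imp_subset by blast
  show thesis
  proof (rule that[of "k ` ball (h p) e"])
    show "openin (top_of_set S2) (k ` ball (h p) e)"
      by (rule openin_sphere_image[OF h]) simp
    show "p \<in> k ` ball (h p) e"
      using hk[of p] assms(1) \<open>- p \<noteq> p\<close> e(1) by (metis centre_in_ball imageI)
    show "k ` ball (h p) e \<subseteq> W"
      using e(2) hk WS by fastforce
    have "k ` ball (h p) e - {p} = k ` (ball (h p) e - {h p})"
      using kh hk[of p] assms(1) \<open>- p \<noteq> p\<close> by (auto simp: image_iff)
    moreover have "connected (ball (h p) e - {h p})"
      by (rule connected_punctured_ball) simp
    moreover have "continuous_on UNIV k"
      using h by (simp add: homeomorphism_def)
    ultimately show "connected (k ` ball (h p) e - {p})"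
      by (metis connected_continuous_image continuous_on_subset subset_UNIV)
  qed
qed

text \<open>The planar theorem in the chart at a point \<open>q\<close> off the curve, with
  \<open>q\<close> put back into the outer side. The last conclusion is local two-sidedness: close
  to the curve, points on the same side are joined within a prescribed neighbourhood.\<close>

lemma Jordan_sphere:
  assumes c: "simple_path c" "pathfinish c = pathstart c" "path_image c \<subseteq> S2"
    and q: "q \<in> S2" "q \<notin> path_image c"
  obtains A B where "A \<inter> B = {}" "A \<union> B = S2 - path_image c"
    "openin (top_of_set S2) A" "openin (top_of_set S2) B" "connected A" "connected B"
    "path_image c \<subseteq> closure A" "path_image c \<subseteq> closure B"
    "\<And>p W. p \<in> path_image c \<Longrightarrow> openin (top_of_set S2) W \<Longrightarrow> p \<in> W \<Longrightarrow>
      \<exists>N. openin (top_of_set S2) N \<and> p \<in> N \<and> N \<subseteq> W \<and>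
        (\<forall>x\<in>N - path_image c. \<forall>y\<in>N - path_image c. (x \<in> A \<longleftrightarrow> y \<in> A) \<longrightarrow>
          connected_component (W - path_image c) x y)"
proof -
  obtain h :: "real^3 \<Rightarrow> complex" and k where h: "homeomorphism (S2 - {q}) UNIV h k"
    using sphere_minus_point_homeomorphism[OF q(1)] by blast
  have hk: "k (h x) = x" if "x \<in> S2" "x \<noteq> q" for x
    using h that by (auto simp: homeomorphism_def)
  have kh: "h (k z) = z" and "k z \<in> S2 - {q}" for z
    using h unfolding homeomorphism_def by (blast, blast)
  then have kS: "k z \<in> S2" "k z \<noteq> q" for z
    by (meson DiffD1, blast)
  have conth: "continuous_on (S2 - {q}) h" and contk: "continuous_on UNIV k"
    using h by (simp_all add: homeomorphism_def)
  define J where "J = path_image c"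
  have JS: "J \<subseteq> S2 - {q}"
    using c q by (auto simp: J_def)
  define c' where "c' = h \<circ> c"
  have hkJ: "k (h x) = x" if "x \<in> J" for x
    using that hk JS by blast
  then have "inj_on h J"
    by (rule inj_on_inverseI)
  then have c': "simple_path c'" "pathfinish c' = pathstart c'"
    unfolding c'_def using c JS conth
    by (auto simp: J_def pathfinish_compose pathstart_compose
        intro!: simple_path_continuous_image intro: continuous_on_subset)
  have img: "path_image c' = h ` J"
    by (simp add: c'_def J_def path_image_compose)
  define I O' where "I = inside (path_image c')" and "O' = outside (path_image c')"
  have IO: "I \<noteq> {}" "open I" "connected I" "O' \<noteq> {}" "open O'" "connected O'" "bounded I"
    "I \<inter> O' = {}" "I \<union> O' = - h ` J" "frontier I = h ` J" "frontier O' = h ` J"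
    using Jordan_inside_outside[OF c'] unfolding I_def O'_def img by auto
  define A B where "A = k ` I" and "B = insert q (k ` O')"
  have kJ: "k ` h ` J = J"
    using hk JS by force
  have inj: "k z = k w \<longleftrightarrow> z = w" for z w
    by (metis kh)
  have all: "S2 - {q} = k ` UNIV"
    using h by (simp add: homeomorphism_def)
  have "UNIV = I \<union> O' \<union> h ` J"
    using IO(9) by blast
  then have cover: "S2 - {q} = A \<union> k ` O' \<union> J"
    unfolding all A_def by (metis image_Un kJ)
  have disj: "A \<inter> k ` O' = {}" "A \<inter> J = {}" "k ` O' \<inter> J = {}"
    using IO(8,9) kJ kh unfolding A_def by (auto simp: disjoint_iff image_iff) (metis Compl_iff UnI1 UnI2 imageI kh)+
  have clI: "closure I = I \<union> h ` J"
    using IO(10) by (simp add: closure_Un_frontier)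
  \<comment> \<open>The inside is bounded, so its closure is compact and \<open>A \<union> J\<close>
    is closed in the whole sphere. This makes \<open>B\<close> open at \<open>q\<close> too.\<close>
  then have "compact (I \<union> h ` J)"
    using IO(7) by (metis compact_closure)
  then have "compact (k ` (I \<union> h ` J))"
    using contk by (meson compact_continuous_image continuous_on_subset subset_UNIV)
  then have K: "closed (A \<union> J)"
    using kJ by (simp add: A_def image_Un compact_imp_closed)
  have AB: "A \<inter> B = {}" "A \<union> B = S2 - J"
    using disj cover kS q(1) JS unfolding A_def B_def by (auto 0 3)
  have opA: "openin (top_of_set S2) A"
    unfolding A_def by (rule openin_sphere_image[OF h IO(2)])
  have "B = S2 - (A \<union> J)"
    using AB by blast
  then have opB: "openin (top_of_set S2) B"
    using K by (auto simp: openin_open)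
  have conA: "connected A" and conO: "connected (k ` O')"
    unfolding A_def using IO(3,6) contk by (meson connected_continuous_image continuous_on_subset subset_UNIV)+
  \<comment> \<open>Otherwise \<open>q\<close>, which is also away from the closed set
    \<open>A \<union> J\<close>, would be isolated in the sphere. So the outer side stays connected
    when \<open>q\<close> is added.\<close>
  have "q \<in> closure (k ` O')"
  proof (rule ccontr)
    assume "q \<notin> closure (k ` O')"
    moreover have "q \<notin> A \<union> J"
      using AB unfolding B_def using JS by blast
    ultimately have "open (- (closure (k ` O') \<union> (A \<union> J)))" "q \<in> - (closure (k ` O') \<union> (A \<union> J))"
      using K \<open>q \<notin> closure (k ` O')\<close> by (blast intro: open_Compl closed_Un closed_closure, blast)
    moreover have "q islimpt S2"
    proof (rule connected_imp_perfect)
      show "connected S2"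
        by (simp add: connected_sphere_eq)
      show "S2 \<noteq> {x}" for x
        using sphere_antipode[OF q(1)] q(1) by (metis singletonD)
    qed (rule q)
    ultimately obtain y where "y \<in> S2" "y \<noteq> q" "y \<in> - (closure (k ` O') \<union> (A \<union> J))"
      unfolding islimpt_def by metis
    then show False
      using cover closure_subset by blast
  qed
  then have conB: "connected B"
    unfolding B_def using closure_subset[of "k ` O'"]
    by (intro connected_intermediate_closure[OF conO] subset_insertI insert_subsetI)
  have "k ` closure I \<subseteq> closure A" "k ` closure O' \<subseteq> closure (k ` O')"
    unfolding A_def using contk by (simp_all add: continuous_image_closure_subset)
  moreover have "h ` J \<subseteq> closure I" "h ` J \<subseteq> closure O'"
    using IO(10,11) by (auto simp: frontier_def)
  moreover have "closure (k ` O') \<subseteq> closure B"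
    unfolding B_def by (intro closure_mono) auto
  ultimately have "k ` h ` J \<subseteq> closure A" "k ` h ` J \<subseteq> closure B"
    by (meson image_mono order_trans)+
  then have clJ: "J \<subseteq> closure A" "J \<subseteq> closure B"
    unfolding kJ .
  have local: "\<exists>N. openin (top_of_set S2) N \<and> p \<in> N \<and> N \<subseteq> W \<and>
      (\<forall>x\<in>N - J. \<forall>y\<in>N - J. (x \<in> A \<longleftrightarrow> y \<in> A) \<longrightarrow> connected_component (W - J) x y)"
    if p: "p \<in> J" and W: "openin (top_of_set S2) W" "p \<in> W" for p W
  proof -
    have pq: "p \<in> S2" "p \<noteq> q"
      using p JS by auto
    have WS: "W \<subseteq> S2"
      using W(1) openin_imp_subset by blast
    obtain N where N: "open N" "h p \<in> N" "N \<subseteq> h ` (W - {q})"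
      "\<And>x y. x \<in> N \<Longrightarrow> y \<in> N \<Longrightarrow> connected_component (- h ` J) x y \<Longrightarrow>
        connected_component (h ` (W - {q}) - h ` J) x y"
      using Jordan_local[OF c' open_plane_image[OF h W(1)], of "h p"] W(2) pq p
      unfolding img by (metis DiffI imageI singletonD)
    have kW: "k ` h ` (W - {q}) = W - {q}"
      using hk WS by force
    have "connected_component (W - J) x y"
      if xy: "x \<in> k ` N - J" "y \<in> k ` N - J" "x \<in> A \<longleftrightarrow> y \<in> A" for x y
    proof -
      obtain x' y' where x': "x = k x'" "x' \<in> N" and y': "y = k y'" "y' \<in> N"
        using xy by blast
      have nJ: "x' \<notin> h ` J" "y' \<notin> h ` J"
        using xy x' y' kJ by blast+
      have "x' \<in> I \<longleftrightarrow> y' \<in> I"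
        using xy(3) x' y' inj unfolding A_def by auto
      then have "x' \<in> I \<and> y' \<in> I \<or> x' \<in> O' \<and> y' \<in> O'"
        using nJ IO(9) by blast
      then have "connected_component (- h ` J) x' y'"
        unfolding connected_component_def using IO(3,6,9) by blast
      then have "connected_component (h ` (W - {q}) - h ` J) x' y'"
        using N(4) x' y' by blast
      moreover have "k ` (h ` (W - {q}) - h ` J) \<subseteq> W - J"
      proof
        fix y assume "y \<in> k ` (h ` (W - {q}) - h ` J)"
        then obtain z where z: "z \<in> h ` (W - {q})" "z \<notin> h ` J" "y = k z"
          by blast
        then have "y \<in> W - {q}"
          using kW by blast
        moreover have "y \<notin> J"
          using z kh by (metis imageI)
        ultimately show "y \<in> W - J"
          by blast
      qed
      ultimately show ?thesis
        unfolding x' y' by (intro connected_component_image[OF _ continuous_on_subset[OF contk]]) auto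
    qed
    moreover have "p \<in> k ` N" "k ` N \<subseteq> W" "openin (top_of_set S2) (k ` N)"
      using N(2,3) kW hk[OF pq] openin_sphere_image[OF h N(1)] by (metis imageI, blast, blast)
    ultimately show ?thesis
      by blast
  qed
  show thesis
    by (rule that[of A B]) (use AB opA opB conA conB clJ local in \<open>simp_all add: J_def\<close>)
qed

section \<open>Graphs on the sphere\<close>

lemma closure_openin_sphere:
  assumes "p \<in> closure S" "openin (top_of_set S2) U" "p \<in> U" "S \<subseteq> S2"
  shows "p \<in> closure (S \<inter> U)"
proof -
  obtain U' where U': "open U'" "U = S2 \<inter> U'"
    using assms(2) by (auto simp: openin_open)
  then have "p \<in> U' \<inter> closure S"
    using assms by auto
  then have "p \<in> closure (U' \<inter> S)"
    using U'(1) open_Int_closure_subset by blast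
  then show ?thesis
    using U'(2) assms(4) by (metis inf.absorb_iff2 inf.left_commute inf_commute)
qed

lemma closure_openin_sphereD:
  assumes "p \<in> closure S" "openin (top_of_set S2) U" "p \<in> U" "S \<subseteq> S2"
  obtains x where "x \<in> S" "x \<in> U"
  using closure_openin_sphere[OF assms] by (metis IntE closure_empty empty_iff equals0I)

lemma openin_sphere_diff:
  assumes "openin (top_of_set S2) U" "closed C"
  shows "openin (top_of_set S2) (U - C)"
proof -
  obtain U' where "open U'" "U = S2 \<inter> U'"
    using assms(1) by (auto simp: openin_open)
  then have "open (U' - C)" "U - C = S2 \<inter> (U' - C)"
    using assms(2) by (auto simp: open_Diff)
  then show ?thesis
    by (auto simp: openin_open)
qed

lemma openin_sphere_minus: "closed C \<Longrightarrow> openin (top_of_set S2) (S2 - C)"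
  by (rule openin_sphere_diff) simp_all

lemma frontier_of_sphere:
  assumes "openin (top_of_set S2) T"
  shows "top_of_set S2 frontier_of T = closure T - T"
proof -
  have "T \<subseteq> S2"
    using assms openin_imp_subset by blast
  then have "closure T \<subseteq> S2"
    by (meson closed_sphere closure_minimal)
  then have "top_of_set S2 closure_of T = closure T"
    using \<open>T \<subseteq> S2\<close> by (simp add: closure_of_subtopology Int_absorb1)
  then show ?thesis
    using assms by (simp add: frontier_of_def interior_of_openin)
qed

definition ends :: "(real \<Rightarrow> real^3) \<Rightarrow> (real^3) set" where
  "ends g = {pathstart g, pathfinish g}"

locale sphere_graph =
  fixes V :: "(real^3) set" and E :: "(real \<Rightarrow> real^3) set"
  assumes embedded: "embedded_graph V E"
begin

lemma finite_V: "finite V" and finite_E: "finite E" and V_sphere: "V \<subseteq> S2"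
  using embedded unfolding embedded_graph_def by simp_all

lemma edge:
  assumes "g \<in> E"
  shows "simple_path g" "path_image g \<subseteq> S2" "pathstart g \<in> V" "pathfinish g \<in> V" "ends g \<subseteq> V"
    "edge_interior g \<inter> V = {}"
  using assms embedded unfolding embedded_graph_def ends_def by blast+

lemma edge_interior_disjoint: "g \<in> E \<Longrightarrow> h \<in> E \<Longrightarrow> g \<noteq> h \<Longrightarrow> edge_interior g \<inter> edge_interior h = {}"
  using embedded unfolding embedded_graph_def by blast

lemma edge_interior_eq: "g \<in> E \<Longrightarrow> edge_interior g = path_image g - ends g"
  using edge(1) simple_path_endless[of g] unfolding edge_interior_def ends_def by auto

lemma path_image_eq: "g \<in> E \<Longrightarrow> path_image g = edge_interior g \<union> ends g"
  using edge_interior_eq pathstart_in_path_image[of g] pathfinish_in_path_image[of g]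
  unfolding ends_def by auto

lemma edge_interior_nonempty: "edge_interior g \<noteq> {}"
  unfolding edge_interior_def by auto

lemma edge_unique:
  assumes "g \<in> E" "h \<in> E" "p \<in> edge_interior g" "p \<in> path_image h"
  shows "g = h"
  using assms edge_interior_disjoint[of g h] edge(6)[OF assms(1)] edge(5)[OF assms(2)]
    path_image_eq[OF assms(2)] by auto

text \<open>It contains the end points of \<open>g\<close>, so its complement in the sphere is an
  open neighbourhood of the interior of \<open>g\<close> that meets the graph in nothing
  else.\<close>

definition rest :: "(real \<Rightarrow> real^3) \<Rightarrow> (real^3) set" where
  "rest g = V \<union> (\<Union>h\<in>E - {g}. path_image h)"

lemma closed_path_images: "F \<subseteq> E \<Longrightarrow> closed (\<Union>h\<in>F. path_image h)"
  using finite_E edge(1) by (intro closed_UN) (auto intro: finite_subset simp: closed_simple_path_image subset_iff)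

lemma closed_rest: "closed (rest g)"
  unfolding rest_def by (rule closed_Un[OF finite_imp_closed[OF finite_V] closed_path_images]) auto

lemma closed_graph: "closed (graph_points V E)"
  unfolding graph_points_def by (rule closed_Un[OF finite_imp_closed[OF finite_V] closed_path_images]) auto

lemma graph_subset_sphere: "graph_points V E \<subseteq> S2"
  unfolding graph_points_def using V_sphere edge(2) by blast

lemma edge_neighbourhood:
  assumes "g \<in> E"
  shows "openin (top_of_set S2) (S2 - rest g)" "edge_interior g \<subseteq> S2 - rest g"
    "(S2 - rest g) \<inter> graph_points V E = edge_interior g"
proof -
  show "openin (top_of_set S2) (S2 - rest g)"
    by (rule openin_sphere_minus[OF closed_rest])
  have "edge_interior g \<inter> rest g = {}"
    using edge(6)[OF assms] edge_unique[OF assms] unfolding rest_def by blast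
  moreover have "edge_interior g \<subseteq> S2"
    using path_image_eq edge(2) assms by blast
  ultimately show sub: "edge_interior g \<subseteq> S2 - rest g"
    by blast
  have "path_image g \<subseteq> edge_interior g \<union> rest g"
    using path_image_eq[OF assms] edge(5)[OF assms] unfolding rest_def by blast
  then have "graph_points V E \<subseteq> edge_interior g \<union> rest g"
    unfolding graph_points_def rest_def by blast
  moreover have "edge_interior g \<subseteq> graph_points V E"
    using path_image_eq assms unfolding graph_points_def by blast
  ultimately show "(S2 - rest g) \<inter> graph_points V E = edge_interior g"
    using sub by blast
qed

text \<open>A point disconnects an arc but not a disc: a neighbourhood of \<open>p\<close> within
  the edge would stay connected without \<open>p\<close>, although the two halves of the edge
  separate it.\<close>

lemma complement_dense_at_edge:
  assumes g: "g \<in> E" and p: "p \<in> edge_interior g"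
  shows "p \<in> closure (S2 - graph_points V E)"
proof (rule ccontr)
  assume np: "p \<notin> closure (S2 - graph_points V E)"
  have "openin (top_of_set S2) ((S2 - rest g) - closure (S2 - graph_points V E))"
    by (rule openin_sphere_diff[OF edge_neighbourhood(1)[OF g] closed_closure])
  moreover have "p \<in> (S2 - rest g) - closure (S2 - graph_points V E)"
    using edge_neighbourhood(2)[OF g] p np by blast
  ultimately obtain N where N: "openin (top_of_set S2) N" "p \<in> N"
    "N \<subseteq> (S2 - rest g) - closure (S2 - graph_points V E)" "connected (N - {p})"
    using sphere_punctured_neighbourhood[of p] by (metis DiffD1 DiffE)
  then have N_edge: "N \<subseteq> edge_interior g"
    using edge_neighbourhood(3)[OF g] closure_subset[of "S2 - graph_points V E"] by blast
  have cont: "continuous_on {0..1} g"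
    using edge(1)[OF g] by (simp add: simple_path_def path_def)
  have inj: "inj_on g {0<..<1}"
    using edge(1)[OF g] unfolding simple_path_def loop_free_def inj_on_def by force
  obtain t where t: "0 < t" "t < 1" "p = g t"
    using p by (auto simp: edge_interior_def)
  obtain N' where N': "open N'" "N = S2 \<inter> N'"
    using N(1) by (auto simp: openin_open)
  have "continuous_on {0<..<1} g"
    using cont by (rule continuous_on_subset) auto
  then have "open (g -` N' \<inter> {0<..<1})"
    using N'(1) by (simp add: continuous_open_vimage continuous_on_open_vimage)
  moreover have "t \<in> g -` N' \<inter> {0<..<1}"
    using t N(2) N'(2) by auto
  ultimately obtain e where e: "e > 0" "ball t e \<subseteq> g -` N' \<inter> {0<..<1}"
    by (meson open_contains_ball)
  have gN: "g s \<in> N - {p}" if "s \<in> ball t e" "s \<noteq> t" for s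
  proof -
    have s: "s \<in> {0<..<1}" "g s \<in> N'"
      using that e by auto
    then have "g s \<in> edge_interior g"
      unfolding edge_interior_def by blast
    then have "g s \<in> S2"
      using path_image_eq[OF g] edge(2)[OF g] by blast
    moreover have "g s \<noteq> p"
      using inj s t that(2) unfolding inj_on_def by auto
    ultimately show ?thesis
      using s N'(2) by auto
  qed
  have cl: "closed (g ` {0..t})" "closed (g ` {t..1})"
    using t by (auto intro!: compact_imp_closed compact_continuous_image intro: continuous_on_subset[OF cont])
  have "N - {p} \<subseteq> g ` {0..t} \<union> g ` {t..1}"
    using N_edge unfolding edge_interior_def by force
  moreover have "g ` {0..t} \<inter> g ` {t..1} \<inter> (N - {p}) = {}"
  proof -
    \<comment> \<open>The edge may still be a loop, whose end point lies in both halves. That point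
      is avoided because \<open>N\<close> is contained in the interior of the edge.\<close>
    have False if ab: "a \<in> {0..t}" "b \<in> {t..1}" "g a = g b" "g a \<in> N" "g a \<noteq> p" for a b
    proof -
      have "g a \<in> g ` {0<..<1}"
        using ab(4) N_edge unfolding edge_interior_def by blast
      then obtain s where s: "0 < s" "s < 1" "g s = g a"
        by force
      have lf: "x = y \<or> x = 0 \<and> y = 1 \<or> x = 1 \<and> y = 0" if "x \<in> {0..1}" "y \<in> {0..1}" "g x = g y" for x y
        using edge(1)[OF g] that unfolding simple_path_def loop_free_def by blast
      have "s = a"
        using lf[of s a] s ab(1) t(1,2) by simp
      moreover have "s = b"
        using lf[of s b] s ab(2,3) t(1,2) by simp
      ultimately have "a = t"
        using ab(1,2) by simp
      then show False
        using ab(5) t(3) by simp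
    qed
    then show ?thesis
      by force
  qed
  ultimately have "g ` {0..t} \<inter> (N - {p}) = {} \<or> g ` {t..1} \<inter> (N - {p}) = {}"
    using connected_closedD[OF N(4) _ _ cl] by blast
  moreover have "g (t - e/2) \<in> g ` {0..t} \<inter> (N - {p})" "g (t + e/2) \<in> g ` {t..1} \<inter> (N - {p})"
  proof -
    have "t - e/2 \<in> ball t e" "t + e/2 \<in> ball t e"
      using e(1) by (auto simp: dist_real_def)
    moreover from this have "t - e/2 \<in> {0<..<1}" "t + e/2 \<in> {0<..<1}"
      using e(2) by blast+
    ultimately show "g (t - e/2) \<in> g ` {0..t} \<inter> (N - {p})" "g (t + e/2) \<in> g ` {t..1} \<inter> (N - {p})"
      using gN[of "t - e/2"] gN[of "t + e/2"] e(1) by auto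
  qed
  ultimately show False
    by blast
qed

lemma tile:
  assumes "T \<in> tiles V E"
  shows "openin (top_of_set S2) T" "connected T" "T \<noteq> {}" "T \<subseteq> S2 - graph_points V E" "T \<subseteq> S2"
proof -
  have "openin (top_of_set S2) (S2 - graph_points V E)"
    by (rule openin_sphere_minus[OF closed_graph])
  moreover have "locally connected S2"
    by (simp add: locally_connected_sphere)
  ultimately show "openin (top_of_set S2) T"
    using assms unfolding tiles_def by (metis openin_components_locally_connected locally_open_subset openin_trans)
  show "connected T" "T \<noteq> {}" "T \<subseteq> S2 - graph_points V E"
    using assms in_components_connected in_components_nonempty in_components_subset unfolding tiles_def
    by (blast, blast, metis)
  then show "T \<subseteq> S2"
    by blast
qed

lemma Union_tiles: "\<Union>(tiles V E) = S2 - graph_points V E"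
  unfolding tiles_def by simp

lemma tiles_disjoint: "T \<in> tiles V E \<Longrightarrow> T' \<in> tiles V E \<Longrightarrow> T \<inter> T' \<noteq> {} \<Longrightarrow> T = T'"
  unfolding tiles_def using components_eq by blast

lemma tile_in_side:
  assumes T: "T \<in> tiles V E" and AB: "A \<inter> B = {}" "T \<subseteq> A \<union> B"
    "openin (top_of_set S2) A" "openin (top_of_set S2) B"
  shows "T \<subseteq> A \<or> T \<subseteq> B"
proof -
  obtain A' B' where op: "open A'" "A = S2 \<inter> A'" "open B'" "B = S2 \<inter> B'"
    using AB(3,4) by (auto simp: openin_open)
  then have "A' \<inter> T = {} \<or> B' \<inter> T = {}"
    using connectedD[OF tile(2)[OF T] op(1,3)] AB(1,2) tile(5)[OF T] by blast
  then show ?thesis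
    using AB(2) op tile(5)[OF T] by blast
qed

text \<open>The tile is clopen in the side that contains it: it is open, and it is relatively closed
  because the side misses its frontier.\<close>

lemma tile_side:
  assumes T: "T \<in> tiles V E" and AB: "A \<inter> B = {}" "A \<union> B = S2 - (closure T - T)"
    "openin (top_of_set S2) A" "openin (top_of_set S2) B" "connected A" "connected B"
  shows "T = A \<or> T = B"
proof -
  have side: "T = C" if "T \<subseteq> C" "connected C" "C \<inter> (closure T - T) = {}" "openin (top_of_set S2) C" for C
  proof -
    have "openin (top_of_set C) T"
      using tile(1)[OF T] that(1,4) by (meson openin_imp_subset openin_subset_trans)
    moreover have "closedin (top_of_set C) T"
    proof -
      have "T = C \<inter> closure T"
        using that(1,3) closure_subset by blast
      then show ?thesis
        by (metis closed_closure closedin_closed_Int)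
    qed
    ultimately show ?thesis
      using that(2) tile(3)[OF T] unfolding connected_clopen by blast
  qed
  have "T \<subseteq> A \<union> B"
    using AB(2) tile(5)[OF T] by blast
  then have "T \<subseteq> A \<or> T \<subseteq> B"
    by (rule tile_in_side[OF T AB(1) _ AB(3,4)])
  then show ?thesis
    using side[of A] side[of B] AB by blast
qed

end

section \<open>Pentagonal tilings\<close>

fun chain :: "(real \<Rightarrow> real^3) list \<Rightarrow> bool" where
  "chain [] \<longleftrightarrow> False"
| "chain [a] \<longleftrightarrow> True"
| "chain (a # b # bs) \<longleftrightarrow> pathfinish a = pathstart b \<and>
     path_image a \<inter> \<Union>(path_image ` set (b # bs)) \<subseteq> {pathstart b} \<and> chain (b # bs)"

fun chain_path :: "(real \<Rightarrow> real^3) list \<Rightarrow> real \<Rightarrow> real^3" where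
  "chain_path [] = undefined"
| "chain_path [a] = a"
| "chain_path (a # b # bs) = a +++ chain_path (b # bs)"

text \<open>The meeting condition in \<open>chain\<close> is the one under which an arc joins the
  arc formed by the rest. Chains grow at the front, as the search for a cycle in
  \<open>cycle_exists\<close> does.\<close>

lemma chain_path:
  assumes "chain as" "\<forall>a\<in>set as. arc a"
  shows "arc (chain_path as) \<and> path_image (chain_path as) = \<Union>(path_image ` set as) \<and>
    pathstart (chain_path as) = pathstart (hd as) \<and> pathfinish (chain_path as) = pathfinish (last as)"
  using assms
proof (induction as rule: chain.induct)
  case (3 a b bs)
  then have IH: "arc (chain_path (b # bs))" "path_image (chain_path (b # bs)) = \<Union>(path_image ` set (b # bs))"
    "pathstart (chain_path (b # bs)) = pathstart b" "pathfinish (chain_path (b # bs)) = pathfinish (last (b # bs))"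
    and a: "arc a" "pathfinish a = pathstart b" "path_image a \<inter> \<Union>(path_image ` set (b # bs)) \<subseteq> {pathstart b}"
    by simp_all
  have "arc (a +++ chain_path (b # bs))"
    by (rule arc_join) (use IH a in simp_all)
  moreover have "path_image (a +++ chain_path (b # bs)) = path_image a \<union> path_image (chain_path (b # bs))"
    by (rule path_image_join) (use IH a in simp)
  ultimately show ?case
    using IH by simp
qed simp_all

lemma chain_append:
  assumes "chain (xs @ ys)" "xs \<noteq> []"
  shows "chain xs" "ys \<noteq> [] \<Longrightarrow> pathfinish (last xs) = pathstart (hd ys)"
  using assms
proof (induction xs rule: chain.induct)
  case (2 a)
  {
    case 1
    then show ?case by simp
  next
    case 2
    then show ?case by (cases ys) simp_all
  }
next
  case (3 a b bs)
  {
    case 1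
    then show ?case using 3 by auto
  next
    case 2
    then show ?case using 3 by auto
  }
qed simp_all

text \<open>This bounds the length of chains of edges. An arc occurring twice would be contained in
  a single joint, hence be a point.\<close>

lemma chain_distinct:
  assumes "chain as" "\<forall>a\<in>set as. arc a"
  shows "distinct as"
  using assms
proof (induction as rule: chain.induct)
  case (3 a b bs)
  have "a \<notin> set (b # bs)"
  proof
    assume "a \<in> set (b # bs)"
    then have "path_image a \<subseteq> {pathstart b}"
      using 3 by auto
    then have "pathstart a = pathfinish a"
      using pathstart_in_path_image[of a] pathfinish_in_path_image[of a] by (metis singletonD subsetD)
    then show False
      using arc_distinct_ends[of a] 3 by simp
  qed
  then show ?case
    using 3 by simp
qed simp_all

section \<open>Boundary cycles of tiles\<close>

lemma ends_reversepath [simp]: "ends (reversepath g) = ends g"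
  by (auto simp: ends_def)

locale pentagonal_sphere = sphere_graph +
  assumes tiling: "pentagonal_tiling V E"
begin

lemma oriented_edge:
  assumes "a \<in> oriented_edges E"
  obtains g where "g \<in> E" "path_image g = path_image a" "ends g = {pathstart a, pathfinish a}"
  using assms unfolding oriented_edges_def ends_def by (auto simp: insert_commute)

text \<open>Peeling one arc after another off the simple closed curve shows that the five corners
  differ. The edges then differ because their pairs of ends do, which also rules out an edge
  traversed in both directions.\<close>

lemma tile_boundary:
  assumes T: "T \<in> tiles V E"
  obtains c v0 v1 v2 v3 v4 g0 g1 g2 g3 g4 where "distinct [v0, v1, v2, v3, v4]" "distinct [g0, g1, g2, g3, g4]"
    "{g0, g1, g2, g3, g4} \<subseteq> E" "ends g0 = {v0, v1}" "ends g1 = {v1, v2}" "ends g2 = {v2, v3}"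
    "ends g3 = {v3, v4}" "ends g4 = {v4, v0}"
    "simple_path c" "pathfinish c = pathstart c" "path_image c = closure T - T"
    "path_image c = \<Union>(path_image ` {g0, g1, g2, g3, g4})"
proof -
  have "pentagonal_boundary E T"
    using tiling T unfolding pentagonal_tiling_def by blast
  then obtain a b c d e where or: "a \<in> oriented_edges E" "b \<in> oriented_edges E" "c \<in> oriented_edges E"
      "d \<in> oriented_edges E" "e \<in> oriented_edges E"
    and j: "pathfinish a = pathstart b" "pathfinish b = pathstart c" "pathfinish c = pathstart d"
      "pathfinish d = pathstart e" "pathfinish e = pathstart a"
    and simple: "simple_path (a +++ b +++ c +++ d +++ e)"
    and front: "top_of_set S2 frontier_of T = path_image (a +++ b +++ c +++ d +++ e)"
    unfolding pentagonal_boundary_def by auto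
  have "arc a" and 1: "arc (b +++ c +++ d +++ e)"
    using simple_path_join_loop_eq[of "b +++ c +++ d +++ e" a] simple j by auto
  have "arc b" and 2: "arc (c +++ d +++ e)" and b: "path_image b \<inter> path_image (c +++ d +++ e) \<subseteq> {pathstart c}"
    using 1 arc_join_eq[of b "c +++ d +++ e"] j by auto
  have "arc c" and 3: "arc (d +++ e)" and c: "path_image c \<inter> path_image (d +++ e) \<subseteq> {pathstart d}"
    using 2 arc_join_eq[of c "d +++ e"] j by auto
  have "arc d" "arc e" and d: "path_image d \<inter> path_image e \<subseteq> {pathstart e}"
    using 3 arc_join_eq[of d e] j by auto
  have img: "path_image (c +++ d +++ e) = path_image c \<union> path_image d \<union> path_image e"
    "path_image (d +++ e) = path_image d \<union> path_image e"
    "path_image (a +++ b +++ c +++ d +++ e) =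
      path_image a \<union> path_image b \<union> path_image c \<union> path_image d \<union> path_image e"
    using j by (auto simp: path_image_join)
  have st: "pathstart b \<in> path_image b" "pathstart c \<in> path_image c" "pathstart d \<in> path_image d"
    "pathstart e \<in> path_image e" "pathstart a \<in> path_image e"
    using pathfinish_in_path_image[of e] j by auto
  have ne: "pathstart a \<noteq> pathstart b" "pathstart b \<noteq> pathstart c" "pathstart c \<noteq> pathstart d"
    "pathstart d \<noteq> pathstart e" "pathstart e \<noteq> pathstart a"
    using \<open>arc a\<close> \<open>arc b\<close> \<open>arc c\<close> \<open>arc d\<close> \<open>arc e\<close> arc_distinct_ends j by metis+
  have ne': "pathstart b \<noteq> pathstart d" "pathstart b \<noteq> pathstart e" "pathstart c \<noteq> pathstart e"
    "pathstart c \<noteq> pathstart a" "pathstart d \<noteq> pathstart a"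
    using st b c d ne unfolding img by auto
  have dist: "distinct [pathstart a, pathstart b, pathstart c, pathstart d, pathstart e]"
    by (simp add: ne ne' ne[symmetric] ne'[symmetric])
  obtain g0 where g0: "g0 \<in> E" "path_image g0 = path_image a" "ends g0 = {pathstart a, pathstart b}"
    using oriented_edge[OF or(1)] j by metis
  obtain g1 where g1: "g1 \<in> E" "path_image g1 = path_image b" "ends g1 = {pathstart b, pathstart c}"
    using oriented_edge[OF or(2)] j by metis
  obtain g2 where g2: "g2 \<in> E" "path_image g2 = path_image c" "ends g2 = {pathstart c, pathstart d}"
    using oriented_edge[OF or(3)] j by metis
  obtain g3 where g3: "g3 \<in> E" "path_image g3 = path_image d" "ends g3 = {pathstart d, pathstart e}"
    using oriented_edge[OF or(4)] j by metis
  obtain g4 where g4: "g4 \<in> E" "path_image g4 = path_image e" "ends g4 = {pathstart e, pathstart a}"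
    using oriented_edge[OF or(5)] j by metis
  have "distinct (map ends [g0, g1, g2, g3, g4])"
    by (simp add: g0 g1 g2 g3 g4 doubleton_eq_iff ne ne' ne[symmetric] ne'[symmetric])
  then have distg: "distinct [g0, g1, g2, g3, g4]"
    by (simp only: distinct_map)
  show thesis
  proof (rule that[OF dist distg])
    show "pathfinish (a +++ b +++ c +++ d +++ e) = pathstart (a +++ b +++ c +++ d +++ e)"
      using j by simp
    show "path_image (a +++ b +++ c +++ d +++ e) = closure T - T"
      using front frontier_of_sphere[OF tile(1)[OF T]] by simp
    show "path_image (a +++ b +++ c +++ d +++ e) = \<Union>(path_image ` {g0, g1, g2, g3, g4})"
      unfolding img using g0 g1 g2 g3 g4 by auto
  qed (use g0 g1 g2 g3 g4 simple in simp_all)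
qed

definition bd :: "(real^3) set \<Rightarrow> (real \<Rightarrow> real^3) set" where
  "bd T = {g \<in> E. path_image g \<subseteq> closure T - T}"

text \<open>An interior point of an edge lies on no other edge, so one such point in the closure of
  the tile puts the whole edge on the boundary.\<close>

lemma bd_I:
  assumes T: "T \<in> tiles V E" and g: "g \<in> E" and p: "p \<in> edge_interior g" "p \<in> closure T"
  shows "g \<in> bd T"
proof (rule tile_boundary[OF T])
  fix c v0 v1 v2 v3 v4 g0 g1 g2 g3 g4
  assume h: "{g0, g1, g2, g3, g4} \<subseteq> E" "path_image c = closure T - T"
    "path_image c = \<Union>(path_image ` {g0, g1, g2, g3, g4})"
  have "p \<notin> T"
    using p(1) tile(4)[OF T] path_image_eq[OF g] g unfolding graph_points_def by blast
  then obtain h where "h \<in> {g0, g1, g2, g3, g4}" "p \<in> path_image h"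
    using p(2) h by auto
  moreover from this have "g = h"
    using edge_unique[OF g _ p(1)] h(1) by blast
  ultimately show ?thesis
    using g h(2,3) unfolding bd_def by blast
qed

lemma bd_D: "g \<in> bd T \<Longrightarrow> g \<in> E" "g \<in> bd T \<Longrightarrow> path_image g \<subseteq> closure T"
  unfolding bd_def by auto

lemma tile_boundary_bd:
  assumes T: "T \<in> tiles V E"
  obtains c v0 v1 v2 v3 v4 g0 g1 g2 g3 g4 where "distinct [v0, v1, v2, v3, v4]" "distinct [g0, g1, g2, g3, g4]"
    "bd T = {g0, g1, g2, g3, g4}" "ends g0 = {v0, v1}" "ends g1 = {v1, v2}" "ends g2 = {v2, v3}"
    "ends g3 = {v3, v4}" "ends g4 = {v4, v0}"
    "simple_path c" "pathfinish c = pathstart c" "path_image c = closure T - T"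
    "path_image c = \<Union>(path_image ` bd T)"
proof (rule tile_boundary[OF T])
  fix c v0 v1 v2 v3 v4 g0 g1 g2 g3 g4
  assume h: "distinct [v0, v1, v2, v3, v4]" "distinct [g0, g1, g2, g3, g4]"
    "{g0, g1, g2, g3, g4} \<subseteq> E" "ends g0 = {v0, v1}" "ends g1 = {v1, v2}" "ends g2 = {v2, v3}"
    "ends g3 = {v3, v4}" "ends g4 = {v4, v0}"
    "simple_path c" "pathfinish c = pathstart c" "path_image c = closure T - T"
    "path_image c = \<Union>(path_image ` {g0, g1, g2, g3, g4})"
  have "bd T = {g0, g1, g2, g3, g4}"
  proof
    show "{g0, g1, g2, g3, g4} \<subseteq> bd T"
      using h(3,11,12) unfolding bd_def by blast
    show "bd T \<subseteq> {g0, g1, g2, g3, g4}"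
    proof
      fix g assume g: "g \<in> bd T"
      obtain p where p: "p \<in> edge_interior g"
        using edge_interior_nonempty by blast
      have "path_image g \<subseteq> \<Union>(path_image ` {g0, g1, g2, g3, g4})"
        using g h(11,12) unfolding bd_def by simp
      then obtain h' where "h' \<in> {g0, g1, g2, g3, g4}" "p \<in> path_image h'"
        using p path_image_eq[of g] bd_D(1)[OF g] by blast
      then show "g \<in> {g0, g1, g2, g3, g4}"
        using edge_unique[OF bd_D(1)[OF g] _ p, of h'] h(3) by blast
    qed
  qed
  then show thesis
    using that[of v0 v1 v2 v3 v4 g0 g1 g2 g3 g4 c] h by simp
qed

section \<open>Jordan curves in the graph and the two tiles at an edge\<close>

lemma exterior_point:
  assumes "E \<noteq> {}"
  obtains q where "q \<in> S2" "q \<notin> graph_points V E"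
proof -
  obtain g where "g \<in> E"
    using assms by blast
  obtain p where "p \<in> edge_interior g"
    using edge_interior_nonempty by blast
  then have "S2 - graph_points V E \<noteq> {}"
    using complement_dense_at_edge[OF \<open>g \<in> E\<close>] by fastforce
  then show thesis
    using that by blast
qed

lemma bd_nonempty: "T \<in> tiles V E \<Longrightarrow> bd T \<noteq> {}"
  by (rule tile_boundary_bd) auto

lemma Jordan_graph:
  assumes c: "simple_path c" "pathfinish c = pathstart c" "path_image c \<subseteq> graph_points V E" and "E \<noteq> {}"
  obtains A B where "A \<inter> B = {}" "A \<union> B = S2 - path_image c"
    "openin (top_of_set S2) A" "openin (top_of_set S2) B" "connected A" "connected B"
    "path_image c \<subseteq> closure A" "path_image c \<subseteq> closure B"
    "\<And>p W. p \<in> path_image c \<Longrightarrow> openin (top_of_set S2) W \<Longrightarrow> p \<in> W \<Longrightarrow>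
      \<exists>N. openin (top_of_set S2) N \<and> p \<in> N \<and> N \<subseteq> W \<and>
        (\<forall>x\<in>N - path_image c. \<forall>y\<in>N - path_image c. (x \<in> A \<longleftrightarrow> y \<in> A) \<longrightarrow>
          connected_component (W - path_image c) x y)"
proof -
  obtain q where q: "q \<in> S2" "q \<notin> graph_points V E"
    using exterior_point[OF assms(4)] by blast
  have *: "path_image c \<subseteq> S2" "q \<notin> path_image c"
    using c(3) graph_subset_sphere q by auto
  show thesis
    by (rule Jordan_sphere[OF c(1,2) *(1) q(1) *(2)]) (rule that)
qed

lemma two_sided_neighbourhood:
  assumes c: "simple_path c" "pathfinish c = pathstart c" "path_image c \<subseteq> graph_points V E" and "E \<noteq> {}"
    and p: "p \<in> path_image c" "openin (top_of_set S2) W" "p \<in> W"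
  obtains A N where "openin (top_of_set S2) N" "p \<in> N" "N \<subseteq> W"
    "\<forall>x\<in>N - path_image c. \<forall>y\<in>N - path_image c. (x \<in> A \<longleftrightarrow> y \<in> A) \<longrightarrow>
      connected_component (W - path_image c) x y"
proof (rule Jordan_graph[OF assms(1-4)])
  fix A
  assume "\<And>p W. p \<in> path_image c \<Longrightarrow> openin (top_of_set S2) W \<Longrightarrow> p \<in> W \<Longrightarrow>
      \<exists>N. openin (top_of_set S2) N \<and> p \<in> N \<and> N \<subseteq> W \<and>
        (\<forall>x\<in>N - path_image c. \<forall>y\<in>N - path_image c. (x \<in> A \<longleftrightarrow> y \<in> A) \<longrightarrow>
          connected_component (W - path_image c) x y)"
  from this[OF p] show thesis
    by (elim exE conjE) (rule that)
qed

lemma boundary_subset_graph: "\<Union>(path_image ` bd T) \<subseteq> graph_points V E"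
  using bd_D(1) unfolding graph_points_def by blast

text \<open>A tile is one of the two Jordan sides of its boundary curve, so at most two tiles share
  a set of boundary edges, and there are finitely many such sets. Finiteness lets closures commute
  with unions of tiles.\<close>

lemma finite_tiles: "finite (tiles V E)"
proof -
  have fin: "finite {T \<in> tiles V E. bd T = bd T0}" if T0: "T0 \<in> tiles V E" for T0
  proof (rule tile_boundary_bd[OF T0])
    fix c assume c: "simple_path c" "pathfinish c = pathstart c" "path_image c = closure T0 - T0"
      "path_image c = \<Union>(path_image ` bd T0)"
    have "E \<noteq> {}"
      using bd_nonempty[OF T0] bd_D(1) by blast
    then obtain A B where AB: "A \<inter> B = {}" "A \<union> B = S2 - path_image c"
      "openin (top_of_set S2) A" "openin (top_of_set S2) B" "connected A" "connected B"
      using Jordan_graph[OF c(1,2)] c(4) boundary_subset_graph by metis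
    have "T = A \<or> T = B" if T: "T \<in> tiles V E" "bd T = bd T0" for T
    proof (rule tile_boundary_bd[OF T(1)])
      fix c' assume "path_image c' = closure T - T" "path_image c' = \<Union>(path_image ` bd T)"
      then have "closure T - T = path_image c"
        using T(2) c(4) by simp
      then show ?thesis
        using tile_side[OF T(1) AB(1) _ AB(3-6)] AB(2) by simp
    qed
    then have "{T \<in> tiles V E. bd T = bd T0} \<subseteq> {A, B}"
      by blast
    then show ?thesis
      by (meson finite.emptyI finite.insertI finite_subset)
  qed
  have "bd ` tiles V E \<subseteq> Pow E"
    using bd_D(1) by blast
  then have "finite (bd ` tiles V E)"
    using finite_E by (meson finite_Pow_iff finite_subset)
  moreover have "tiles V E = (\<Union>F\<in>bd ` tiles V E. {T \<in> tiles V E. bd T = F})"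
    by blast
  moreover have "finite (\<Union>F\<in>bd ` tiles V E. {T \<in> tiles V E. bd T = F})"
    using fin calculation(1) by (intro finite_UN_I) auto
  ultimately show ?thesis
    by simp
qed

lemma tile_near:
  assumes W: "openin (top_of_set S2) W" "p \<in> W" and S: "S \<subseteq> S2" "p \<in> closure S" "S \<inter> W \<subseteq> S2 - graph_points V E"
  obtains T where "T \<in> tiles V E" "p \<in> closure (T \<inter> S)"
proof -
  have "p \<in> closure (S \<inter> W)"
    by (rule closure_openin_sphere[OF S(2) W S(1)])
  also have "S \<inter> W \<subseteq> (\<Union>T\<in>tiles V E. T \<inter> S)"
    using S(3) Union_tiles by blast
  then have "closure (S \<inter> W) \<subseteq> closure (\<Union>T\<in>tiles V E. T \<inter> S)"
    by (rule closure_mono)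
  also have "\<dots> = (\<Union>T\<in>tiles V E. closure (T \<inter> S))"
    using finite_tiles by (induction rule: finite_induct) auto
  finally show thesis
    using that by blast
qed

lemma tile_on_side:
  assumes g: "g \<in> E" and p: "p \<in> edge_interior g" and S: "S \<subseteq> S2" "p \<in> closure S" "S \<inter> edge_interior g = {}"
  obtains T where "T \<in> tiles V E" "g \<in> bd T" "T \<inter> S \<noteq> {}"
proof -
  have pW: "p \<in> S2 - rest g"
    using edge_neighbourhood(2)[OF g] p by blast
  have "S \<inter> (S2 - rest g) \<subseteq> S2 - graph_points V E"
    using edge_neighbourhood(3)[OF g] S(3) by blast
  then obtain T where T: "T \<in> tiles V E" "p \<in> closure (T \<inter> S)"
    using tile_near[OF edge_neighbourhood(1)[OF g] pW S(1,2)] by blast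
  then have "p \<in> closure T" "T \<inter> S \<noteq> {}"
    using closure_mono[of "T \<inter> S" T] by auto
  then show thesis
    using that T(1) bd_I[OF T(1) g p] by blast
qed

text \<open>Pigeonhole on the sides of the boundary curve of \<open>T1\<close>: two of the three
  tiles have points near \<open>p\<close> on the same side. By local two-sidedness these are joined
  off the graph, hence lie in one tile.\<close>

lemma at_most_two_tiles:
  assumes T: "T1 \<in> tiles V E" "T2 \<in> tiles V E" "T3 \<in> tiles V E"
    and g: "g \<in> bd T1" "g \<in> bd T2" "g \<in> bd T3"
  shows "T1 = T2 \<or> T1 = T3 \<or> T2 = T3"
proof (rule tile_boundary_bd[OF T(1)])
  fix c assume c: "simple_path c" "pathfinish c = pathstart c" "path_image c = closure T1 - T1"
    "path_image c = \<Union>(path_image ` bd T1)"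
  have gE: "g \<in> E"
    using bd_D(1)[OF g(1)] .
  then have "E \<noteq> {}"
    by blast
  have cG: "path_image c \<subseteq> graph_points V E"
    using c(4) boundary_subset_graph by metis
  obtain p where p: "p \<in> edge_interior g"
    using edge_interior_nonempty by blast
  have gc: "edge_interior g \<subseteq> path_image c"
    using c(4) g(1) path_image_eq[OF gE] by blast
  let ?W = "S2 - rest g"
  have pW: "p \<in> ?W"
    using edge_neighbourhood(2)[OF gE] p by blast
  obtain A N where N: "openin (top_of_set S2) N" "p \<in> N" "N \<subseteq> ?W"
    "\<forall>x\<in>N - path_image c. \<forall>y\<in>N - path_image c. (x \<in> A \<longleftrightarrow> y \<in> A) \<longrightarrow>
      connected_component (?W - path_image c) x y"
    by (rule two_sided_neighbourhood[OF c(1,2) cG \<open>E \<noteq> {}\<close> subsetD[OF gc p] edge_neighbourhood(1)[OF gE] pW])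
  have WG: "?W - path_image c \<subseteq> S2 - graph_points V E"
    using edge_neighbourhood(3)[OF gE] gc by blast
  have near: "\<exists>x\<in>N - path_image c. x \<in> T" if "T \<in> tiles V E" "g \<in> bd T" for T
  proof -
    have "p \<in> closure T"
      using bd_D[OF that(2)] p path_image_eq[OF gE] by blast
    then obtain x where "x \<in> T" "x \<in> N"
      using closure_openin_sphereD[OF _ N(1,2)] tile(5)[OF \<open>T \<in> tiles V E\<close>] by blast
    then show ?thesis
      using tile(4)[OF that(1)] cG by blast
  qed
  have same: "T = T'" if "T \<in> tiles V E" "T' \<in> tiles V E" "x \<in> N - path_image c" "y \<in> N - path_image c"
    "x \<in> T" "y \<in> T'" "x \<in> A \<longleftrightarrow> y \<in> A" for T T' x y
  proof -
    have "connected_component (S2 - graph_points V E) x y"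
      using N(4) that(3,4,7) WG connected_component_of_subset by blast
    then obtain C where C: "connected C" "C \<subseteq> S2 - graph_points V E" "x \<in> C" "y \<in> C"
      unfolding connected_component_def by blast
    then have "C \<subseteq> T" "C \<subseteq> T'"
      using that(1,2,5,6) unfolding tiles_def by (meson components_maximal disjoint_iff)+
    then show ?thesis
      using C(3) tiles_disjoint[OF that(1,2)] by blast
  qed
  obtain x1 x2 x3 where x: "x1 \<in> N - path_image c" "x2 \<in> N - path_image c" "x3 \<in> N - path_image c"
    "x1 \<in> T1" "x2 \<in> T2" "x3 \<in> T3"
    using near T g by meson
  have "(x1 \<in> A \<longleftrightarrow> x2 \<in> A) \<or> (x1 \<in> A \<longleftrightarrow> x3 \<in> A) \<or> (x2 \<in> A \<longleftrightarrow> x3 \<in> A)"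
    by blast
  then show ?thesis
    using same[OF T(1,2) x(1,2,4,5)] same[OF T(1,3) x(1,3,4,6)] same[OF T(2,3) x(2,3,5,6)] by blast
qed

text \<open>Density of the complement gives one tile \<open>T\<close> at the edge. It is a whole
  side of its boundary curve, so a tile approaching the edge from the other side is a second
  one.\<close>

lemma two_sides:
  assumes g: "g \<in> E"
  obtains T1 T2 where "T1 \<in> tiles V E" "T2 \<in> tiles V E" "T1 \<noteq> T2" "g \<in> bd T1" "g \<in> bd T2"
proof -
  have "E \<noteq> {}"
    using g by blast
  obtain p where p: "p \<in> edge_interior g"
    using edge_interior_nonempty by blast
  have "edge_interior g \<subseteq> graph_points V E"
    using edge_neighbourhood(3)[OF g] by blast
  then have disj: "(S2 - graph_points V E) \<inter> edge_interior g = {}"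
    by blast
  obtain T where T: "T \<in> tiles V E" "g \<in> bd T"
    using tile_on_side[OF g p _ complement_dense_at_edge[OF g p] disj] by blast
  show thesis
  proof (rule tile_boundary_bd[OF T(1)])
    fix c assume c: "simple_path c" "pathfinish c = pathstart c" "path_image c = closure T - T"
      "path_image c = \<Union>(path_image ` bd T)"
    have cG: "path_image c \<subseteq> graph_points V E"
      using c(4) boundary_subset_graph by metis
    have gc: "edge_interior g \<subseteq> path_image c"
      using c(4) T(2) path_image_eq[OF g] by blast
    obtain A B where AB: "A \<inter> B = {}" "A \<union> B = S2 - path_image c"
      "openin (top_of_set S2) A" "openin (top_of_set S2) B" "connected A" "connected B"
      "path_image c \<subseteq> closure A" "path_image c \<subseteq> closure B"
      by (rule Jordan_graph[OF c(1,2) cG \<open>E \<noteq> {}\<close>]) (rule that; assumption)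
    have side: "T = A \<or> T = B"
      using tile_side[OF T(1) AB(1) _ AB(3-6)] AB(2) c(3) by simp
    define S where "S = (if T = A then B else A)"
    have "S = A \<or> S = B"
      by (simp add: S_def)
    then have "S \<subseteq> S2 - path_image c" "path_image c \<subseteq> closure S"
      using AB(2,7,8) by auto
    then have S: "S \<subseteq> S2" "p \<in> closure S" "S \<inter> edge_interior g = {}"
      using gc p by blast+
    have "T \<inter> S = {}"
      using AB(1) side unfolding S_def by auto
    obtain T' where T': "T' \<in> tiles V E" "g \<in> bd T'" "T' \<inter> S \<noteq> {}"
      by (rule tile_on_side[OF g p S])
    then have "T \<noteq> T'"
      using \<open>T \<inter> S = {}\<close> by blast
    then show thesis
      by (rule that[OF T(1) T'(1) _ T(2) T'(2)])
  qed
qed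

lemma card_tiles_at_edge:
  assumes "g \<in> E"
  shows "card {T \<in> tiles V E. g \<in> bd T} = 2"
proof (rule two_sides[OF assms])
  fix T1 T2 assume T: "T1 \<in> tiles V E" "T2 \<in> tiles V E" "T1 \<noteq> T2" "g \<in> bd T1" "g \<in> bd T2"
  have "S = T1 \<or> S = T2" if "S \<in> tiles V E" "g \<in> bd S" for S
    using at_most_two_tiles[OF T(1,2) that(1) T(4,5) that(2)] T(3) by auto
  with T have "{T \<in> tiles V E. g \<in> bd T} = {T1, T2}"
    by auto
  then show ?thesis
    using T(3) by simp
qed

text \<open>Every edge is a side of some tile, and the corners of a tile are distinct, so there are
  no loops.\<close>

lemma edge_arc:
  assumes "g \<in> E"
  shows "arc g" "pathstart g \<noteq> pathfinish g"
proof -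
  obtain T where T: "T \<in> tiles V E" "g \<in> bd T"
    using two_sides[OF assms] by blast
  show ne: "pathstart g \<noteq> pathfinish g"
  proof (rule tile_boundary_bd[OF T(1)])
    fix v0 v1 v2 v3 v4 g0 g1 g2 g3 g4
    assume dist: "distinct [v0, v1, v2, v3, v4]" and bd: "bd T = {g0, g1, g2, g3, g4}"
      and e: "ends g0 = {v0, v1}"
      "ends g1 = {v1, v2}" "ends g2 = {v2, v3}" "ends g3 = {v3, v4}" "ends g4 = {v4, v0}"
    have "ends g \<in> ends ` bd T"
      using T(2) by blast
    then have "ends g = {v0, v1} \<or> ends g = {v1, v2} \<or> ends g = {v2, v3} \<or> ends g = {v3, v4} \<or> ends g = {v4, v0}"
      by (simp add: bd e)
    moreover have "v0 \<noteq> v1" "v1 \<noteq> v2" "v2 \<noteq> v3" "v3 \<noteq> v4" "v4 \<noteq> v0"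
      using dist by auto
    ultimately have "\<exists>x y. x \<noteq> y \<and> ends g = {x, y}"
      by blast
    then show ?thesis
      unfolding ends_def by (auto simp: doubleton_eq_iff)
  qed
  then show "arc g"
    using edge(1)[OF assms] by (simp add: arc_simple_path)
qed

lemma vertex_degree_ends: "vertex_degree E v = card {g \<in> E. v \<in> ends g}"
proof -
  have "{g \<in> E. v \<in> ends g} = {g \<in> E. pathstart g = v} \<union> {g \<in> E. pathfinish g = v}"
    by (auto simp: ends_def)
  moreover have "{g \<in> E. pathstart g = v} \<inter> {g \<in> E. pathfinish g = v} = {}"
    using edge_arc(2) by fastforce
  ultimately show ?thesis
    unfolding vertex_degree_def using finite_E by (simp add: card_Un_disjoint)
qed

section \<open>Cycles of edges and the tiles on their two sides\<close>

lemma vertex_on_edge: "g \<in> E \<Longrightarrow> u \<in> V \<Longrightarrow> u \<in> path_image g \<Longrightarrow> u \<in> ends g"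
  using path_image_eq edge(6) by blast

text \<open>The first vertex of a longest chain of edges of \<open>M\<close> lies on a second edge
  of \<open>M\<close>. By maximality the other end of that edge is already on the chain, and cutting
  the chain there leaves a cycle.\<close>

lemma cycle_exists:
  assumes M: "M \<subseteq> E" "M \<noteq> {}" and deg: "\<And>u. u \<noteq> v \<Longrightarrow> card {e \<in> M. u \<in> ends e} \<noteq> 1"
  obtains c K where "K \<subseteq> M" "K \<noteq> {}" "simple_path c" "pathfinish c = pathstart c"
    "path_image c = \<Union>(path_image ` K)"
proof -
  define OM where "OM = M \<union> reversepath ` M"
  have OM: "\<exists>g\<in>M. path_image g = path_image a \<and> ends g = ends a" "arc a" if "a \<in> OM" for a
    using that edge_arc(1) M(1) unfolding OM_def by (auto simp: arc_reversepath)
  have orient: "\<exists>a\<in>OM. path_image a = path_image g \<and> pathfinish a = u \<and> ends a = ends g" if "g \<in> M" "u \<in> ends g" for g u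
  proof (cases "pathfinish g = u")
    case True
    then show ?thesis
      using that unfolding OM_def by blast
  next
    case False
    then have "pathfinish (reversepath g) = u"
      using that(2) by (auto simp: ends_def)
    moreover have "reversepath g \<in> OM"
      using that(1) unfolding OM_def by blast
    ultimately show ?thesis
      by (metis ends_reversepath path_image_reversepath)
  qed
  \<comment> \<open>All chains end at \<open>b\<close>. Choosing \<open>v\<close> whenever
    \<open>v\<close> is on an edge of \<open>M\<close> keeps the free end of a chain away from
    \<open>v\<close>, the only vertex that may have degree one in \<open>M\<close>.\<close>
  define b where "b = (if \<exists>e\<in>M. v \<in> ends e then v else pathfinish (SOME e. e \<in> M))"
  have b: "\<exists>e\<in>M. b \<in> ends e" "b \<noteq> v \<Longrightarrow> \<forall>e\<in>M. v \<notin> ends e"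
  proof -
    have "(SOME e. e \<in> M) \<in> M"
      using M(2) by (simp add: some_in_eq)
    then show "\<exists>e\<in>M. b \<in> ends e"
      unfolding b_def by (auto simp: ends_def)
    show "b \<noteq> v \<Longrightarrow> \<forall>e\<in>M. v \<notin> ends e"
      unfolding b_def by metis
  qed
  define P where "P as \<longleftrightarrow> chain as \<and> set as \<subseteq> OM \<and> pathfinish (last as) = b" for as
  obtain a0 where "a0 \<in> OM" "pathfinish a0 = b"
    using b(1) orient by blast
  then have "P [a0]"
    by (simp add: P_def)
  have finOM: "finite OM"
    using M(1) finite_E finite_subset unfolding OM_def by auto
  have bound: "length as \<le> card OM" if "P as" for as
  proof -
    have "distinct as" "set as \<subseteq> OM"
      using that OM(2) chain_distinct unfolding P_def by blast+
    then show ?thesis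
      using card_mono[OF finOM] distinct_card by metis
  qed
  obtain as where as: "P as" "\<And>bs. P bs \<Longrightarrow> length bs \<le> length as"
    using ex_has_greatest_nat[of P "[a0]" length "card OM + 1"] \<open>P [a0]\<close> bound by (metis less_Suc_eq_le Suc_eq_plus1)
  obtain a bs where a: "as = a # bs"
    using as(1) unfolding P_def by (cases as) auto
  have chain: "chain as" and sub: "set as \<subseteq> OM" and last: "pathfinish (last as) = b"
    using as(1) unfolding P_def by blast+
  have arcs: "\<forall>a\<in>set as. arc a"
    using sub OM(2) by blast
  define y where "y = pathstart a"
  have "arc (chain_path as)" "pathstart (chain_path as) = y" "pathfinish (chain_path as) = b"
    using chain_path[OF chain arcs] last by (simp_all add: a y_def)
  then have "y \<noteq> b"
    using arc_distinct_ends by metis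
  obtain ga where ga: "ga \<in> M" "path_image ga = path_image a" "ends ga = ends a"
    using OM(1)[of a] sub a by auto
  have y_ga: "y \<in> ends ga"
    unfolding ga(3) by (simp add: y_def ends_def)
  have "y \<noteq> v"
    using b(2) \<open>y \<noteq> b\<close> ga(1) y_ga by blast
  have "{e \<in> M. y \<in> ends e} \<noteq> {ga}"
  proof
    assume eq: "{e \<in> M. y \<in> ends e} = {ga}"
    show False
      using deg[OF \<open>y \<noteq> v\<close>] unfolding eq by simp
  qed
  then obtain e' where e': "e' \<in> M" "y \<in> ends e'" "e' \<noteq> ga"
    using ga(1) y_ga by blast
  then obtain a' where a': "a' \<in> OM" "path_image a' = path_image e'" "pathfinish a' = y" "ends a' = ends e'"
    using orient by blast
  define z where "z = pathstart a'"
  have "z \<noteq> y"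
    using arc_distinct_ends[OF OM(2)[OF a'(1)]] a'(3) by (simp add: z_def)
  have ends_e': "ends e' = {y, z}"
    using a'(3,4) by (auto simp: ends_def z_def)
  have e'E: "e' \<in> E"
    using e'(1) M(1) by blast
  have y_tail: "y \<notin> path_image x" if xbs: "x \<in> set bs" for x
  proof
    assume "y \<in> path_image x"
    obtain b' bs' where bs: "bs = b' # bs'"
      using xbs by (cases bs) auto
    have "path_image a \<inter> \<Union>(path_image ` set bs) \<subseteq> {pathfinish a}"
      using chain a bs by simp
    then have "y = pathfinish a"
      using \<open>y \<in> path_image x\<close> xbs unfolding y_def by auto
    then show False
      using arcs a arc_distinct_ends[of a] by (simp add: y_def)
  qed
  have disj: "edge_interior e' \<inter> path_image x = {}" if x: "x \<in> set as" for x
  proof -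
    obtain g where g: "g \<in> M" "path_image g = path_image x"
      using OM(1)[of x] sub x by auto
    have "g \<noteq> e'"
    proof
      assume "g = e'"
      have "y \<in> path_image x"
        using y_ga ends_e' path_image_eq[OF e'E] g(2) \<open>g = e'\<close> by auto
      then have "x = a"
        using x a y_tail by auto
      then have "path_image e' = path_image ga"
        using g(2) \<open>g = e'\<close> ga(2) by simp
      then have "e' = ga"
        using edge_unique[OF e'E, of ga] edge_interior_nonempty[of e'] path_image_eq[OF e'E] ga(1) M(1) by blast
      then show False
        using e'(3) by blast
    qed
    then show ?thesis
      using edge_unique[OF e'E, of g] g M(1) by blast
  qed
  have meet: "path_image a' \<inter> \<Union>(path_image ` set as) \<subseteq> {y, z}"
    using disj path_image_eq[OF e'E] ends_e' a'(2) by blast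
  have "z \<in> \<Union>(path_image ` set as)"
  proof (rule ccontr)
    assume "z \<notin> \<Union>(path_image ` set as)"
    then have "path_image a' \<inter> \<Union>(path_image ` set as) \<subseteq> {y}"
      using meet by blast
    then have "P (a' # as)"
      using as(1) a'(1,3) unfolding P_def a y_def by simp
    then show False
      using as(2)[of "a' # as"] by simp
  qed
  then obtain x where x: "x \<in> set as" "z \<in> path_image x"
    by blast
  then obtain g where g: "g \<in> M" "path_image g = path_image x" "ends g = ends x"
    using OM(1)[of x] sub by auto
  have "z \<in> V"
    using ends_e' edge(5)[OF e'E] by blast
  then have "z \<in> ends x"
    using vertex_on_edge[of g z] g M(1) x(2) by auto
  then have zx: "z = pathstart x \<or> z = pathfinish x"
    by (auto simp: ends_def)
  obtain us ws where us: "as = us @ x # ws"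
    using x(1) split_list by metis
  \<comment> \<open>The chain is cut at \<open>z\<close>: right after \<open>x\<close> if
    \<open>x\<close> finishes at \<open>z\<close>, and right before \<open>x\<close> if
    \<open>x\<close> starts there. In the latter case something remains, because the whole chain
    starts at \<open>y \<noteq> z\<close>.\<close>
  have "\<exists>xs ys. as = xs @ ys \<and> xs \<noteq> [] \<and> pathfinish (last xs) = z"
  proof (cases "z = pathfinish x")
    case True
    then have "as = (us @ [x]) @ ws \<and> us @ [x] \<noteq> [] \<and> pathfinish (last (us @ [x])) = z"
      using us by simp
    then show ?thesis
      by blast
  next
    case False
    then have zs: "z = pathstart x"
      using zx by blast
    then have "us \<noteq> []"
      using us a \<open>z \<noteq> y\<close> unfolding y_def by auto
    moreover have "pathfinish (last us) = z"
      using chain_append(2)[of us "x # ws"] chain us zs \<open>us \<noteq> []\<close> by simp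
    ultimately show ?thesis
      using us by blast
  qed
  then obtain xs ys where xs: "as = xs @ ys" "xs \<noteq> []" "pathfinish (last xs) = z"
    by blast
  have "hd xs = a"
    using xs(1,2) a by (metis hd_append2 list.sel(1))
  have "chain xs" "\<forall>a\<in>set xs. arc a"
    using chain_append(1) chain xs arcs by auto
  note cp = chain_path[OF this]
  have sub': "set xs \<subseteq> set as"
    using xs(1) by auto
  define K where "K = {e \<in> M. \<exists>x\<in>set (a' # xs). path_image e = path_image x}"
  have "simple_path (a' +++ chain_path xs)"
  proof (rule simple_path_join_loop)
    show "arc a'"
      by (rule OM(2)[OF a'(1)])
    show "path_image a' \<inter> path_image (chain_path xs) \<subseteq> {pathstart a', pathstart (chain_path xs)}"
      using cp meet sub' \<open>hd xs = a\<close> unfolding z_def y_def by auto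
  qed (use cp a'(3) \<open>hd xs = a\<close> xs(3) in \<open>simp_all add: y_def z_def\<close>)
  moreover have "pathfinish (a' +++ chain_path xs) = pathstart (a' +++ chain_path xs)"
    using cp xs(3) by (simp add: z_def)
  moreover have "path_image (a' +++ chain_path xs) = \<Union>(path_image ` set (a' # xs))"
    using cp a'(3) \<open>hd xs = a\<close> by (simp add: path_image_join y_def)
  moreover have "\<Union>(path_image ` set (a' # xs)) = \<Union>(path_image ` K)"
  proof
    show "\<Union>(path_image ` K) \<subseteq> \<Union>(path_image ` set (a' # xs))"
      unfolding K_def by blast
    have "\<exists>e\<in>K. path_image e = path_image x" if "x \<in> set (a' # xs)" for x
    proof -
      have "x \<in> OM"
        using that sub sub' a'(1) by auto
      then show ?thesis
        using OM(1)[of x] that unfolding K_def by auto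
    qed
    then show "\<Union>(path_image ` set (a' # xs)) \<subseteq> \<Union>(path_image ` K)"
      by blast
  qed
  moreover have "K \<subseteq> M" "e' \<in> K"
    using e'(1) a'(2) unfolding K_def by auto
  ultimately show thesis
    using that[of K "a' +++ chain_path xs"] by auto
qed

text \<open>\<open>X\<close> is the set of tiles in one side of a cycle in \<open>M\<close>. Edges
  of the cycle have tiles on either side, whereas an edge off the cycle has an interior point in one
  side, which forces both of its tiles into that side.\<close>

lemma separating_tiles:
  assumes M: "M \<subseteq> E" "M \<noteq> {}" and deg: "\<And>u. u \<noteq> v \<Longrightarrow> card {e \<in> M. u \<in> ends e} \<noteq> 1"
  obtains X where "X \<subseteq> tiles V E"
    "{e \<in> E. \<exists>T\<in>X. \<exists>T'\<in>tiles V E - X. e \<in> bd T \<and> e \<in> bd T'} \<noteq> {}"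
    "{e \<in> E. \<exists>T\<in>X. \<exists>T'\<in>tiles V E - X. e \<in> bd T \<and> e \<in> bd T'} \<subseteq> M"
proof -
  obtain c K where c: "K \<subseteq> M" "K \<noteq> {}" "simple_path c" "pathfinish c = pathstart c"
    "path_image c = \<Union>(path_image ` K)"
    by (rule cycle_exists[OF M deg])
  have cG: "path_image c \<subseteq> graph_points V E"
    using c(1,5) M(1) unfolding graph_points_def by blast
  have "E \<noteq> {}"
    using M by blast
  obtain A B where AB: "A \<inter> B = {}" "A \<union> B = S2 - path_image c"
      "openin (top_of_set S2) A" "openin (top_of_set S2) B"
      "path_image c \<subseteq> closure A" "path_image c \<subseteq> closure B"
    by (rule Jordan_graph[OF c(3,4) cG \<open>E \<noteq> {}\<close>]) (rule that; assumption)
  define X where "X = {T \<in> tiles V E. T \<subseteq> A}"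
  have side: "T \<subseteq> A \<or> T \<subseteq> B" if "T \<in> tiles V E" for T
  proof (rule tile_in_side[OF that AB(1) _ AB(3,4)])
    show "T \<subseteq> A \<union> B"
      using AB(2) cG tile(4)[OF that] by blast
  qed
  have AS: "A \<subseteq> S2" "B \<subseteq> S2"
    using AB(2) by blast+
  show thesis
  proof (rule that)
    show "X \<subseteq> tiles V E"
      by (auto simp: X_def)
    obtain e where e: "e \<in> K"
      using c(2) by blast
    then have eE: "e \<in> E"
      using c(1) M(1) by blast
    obtain p where p: "p \<in> edge_interior e"
      using edge_interior_nonempty by blast
    have ec: "edge_interior e \<subseteq> path_image c"
      using e c(5) path_image_eq[OF eE] by blast
    have "p \<in> closure A" "p \<in> closure B" "A \<inter> edge_interior e = {}" "B \<inter> edge_interior e = {}"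
      using ec p AB(2,5,6) by blast+
    then obtain T T' where T: "T \<in> tiles V E" "e \<in> bd T" "T \<inter> A \<noteq> {}" "T' \<in> tiles V E" "e \<in> bd T'" "T' \<inter> B \<noteq> {}"
      using tile_on_side[OF eE p] AS by metis
    then have "T \<in> X" "T' \<notin> X"
      using side[of T] side[of T'] AB(1) unfolding X_def by blast+
    then show "{e \<in> E. \<exists>T\<in>X. \<exists>T'\<in>tiles V E - X. e \<in> bd T \<and> e \<in> bd T'} \<noteq> {}"
      using T eE by blast
    show "{e \<in> E. \<exists>T\<in>X. \<exists>T'\<in>tiles V E - X. e \<in> bd T \<and> e \<in> bd T'} \<subseteq> M"
    proof
      fix e assume "e \<in> {e \<in> E. \<exists>T\<in>X. \<exists>T'\<in>tiles V E - X. e \<in> bd T \<and> e \<in> bd T'}"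
      then obtain T T' where T: "e \<in> E" "T \<in> tiles V E" "T \<subseteq> A" "T' \<in> tiles V E" "T' \<subseteq> B" "e \<in> bd T" "e \<in> bd T'"
        using side unfolding X_def by blast
      obtain p where p: "p \<in> edge_interior e"
        using edge_interior_nonempty by blast
      have cl: "p \<in> closure T" "p \<in> closure T'"
        using p path_image_eq[OF T(1)] bd_D(2)[OF T(6)] bd_D(2)[OF T(7)] by blast+
      show "e \<in> M"
      proof (rule ccontr)
        assume "e \<notin> M"
        then have "p \<notin> path_image c"
          using c(1,5) M(1) edge_unique[OF T(1) _ p] by blast
        then have "p \<in> A \<or> p \<in> B"
          using AB(2) p path_image_eq[OF T(1)] edge(2)[OF T(1)] by blast
        then show False
        proof
          assume "p \<in> A"
          then obtain x where "x \<in> T'" "x \<in> A"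
            using closure_openin_sphereD[OF cl(2) AB(3)] tile(5)[OF T(4)] by blast
          then show False
            using T(5) AB(1) by blast
        next
          assume "p \<in> B"
          then obtain x where "x \<in> T" "x \<in> B"
            using closure_openin_sphereD[OF cl(1) AB(4)] tile(5)[OF T(2)] by blast
          then show False
            using T(3) AB(1) by blast
        qed
      qed
    qed
  qed
qed

section \<open>The link of a vertex\<close>

lemma closure_edge_interior:
  assumes "g \<in> E"
  shows "path_image g \<subseteq> closure (edge_interior g)"
proof -
  have "continuous_on (closure {0<..<1::real}) g"
    using edge(1)[OF assms] by (simp add: simple_path_def path_def)
  then have "g ` closure {0<..<1} \<subseteq> closure (g ` {0<..<1})"
    by (rule continuous_image_closure_subset) simp
  then show ?thesis
    by (simp add: path_image_def edge_interior_def)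
qed

text \<open>A small punctured neighbourhood of \<open>v\<close> is connected and covered by two
  closed sets: the closed tiles at edges in \<open>C\<close>, and those at the other edges of
  \<open>v\<close>. At a common point two tiles of different kinds would share an edge at
  \<open>v\<close>, across which \<open>C\<close> spreads. So one set is empty there, yet every edge
  at \<open>v\<close> comes arbitrarily close to \<open>v\<close>.\<close>

lemma vertex_link_connected:
  assumes v: "v \<in> V" and C: "C \<subseteq> {e \<in> E. v \<in> ends e}" "C \<noteq> {}"
    and closed: "\<And>T e e'. T \<in> tiles V E \<Longrightarrow> e \<in> bd T \<Longrightarrow> e' \<in> bd T \<Longrightarrow> v \<in> ends e \<Longrightarrow> v \<in> ends e' \<Longrightarrow> e \<in> C \<Longrightarrow> e' \<in> C"
  shows "C = {e \<in> E. v \<in> ends e}"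
proof (rule ccontr)
  define C' where "C' = {e \<in> E. v \<in> ends e} - C"
  assume "C \<noteq> {e \<in> E. v \<in> ends e}"
  then have C': "C' \<noteq> {}" "C' \<subseteq> E"
    using C(1) unfolding C'_def by blast+
  \<comment> \<open>What stays away from \<open>v\<close>. It is closed because there are finitely
    many tiles, so a small neighbourhood of \<open>v\<close> meets only edges and closed tiles that
    contain \<open>v\<close>.\<close>
  define D where "D = (V - {v}) \<union> \<Union>(path_image ` {e \<in> E. v \<notin> ends e}) \<union>
    \<Union>(closure ` {T \<in> tiles V E. v \<notin> closure T})"
  have "closed (\<Union>(path_image ` {e \<in> E. v \<notin> ends e}))"
    by (rule closed_path_images) blast
  moreover have "closed (\<Union>(closure ` {T \<in> tiles V E. v \<notin> closure T}))"
    using finite_tiles by (intro closed_UN) auto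
  moreover have "closed (V - {v})"
    using finite_V by (simp add: finite_imp_closed)
  ultimately have "closed D"
    unfolding D_def by (intro closed_Un)
  have "v \<notin> D"
    unfolding D_def using vertex_on_edge v by auto
  have vS: "v \<in> S2"
    using v V_sphere by blast
  obtain N where N: "openin (top_of_set S2) N" "v \<in> N" "N \<subseteq> S2 - D" "connected (N - {v})"
    by (rule sphere_punctured_neighbourhood[OF vS openin_sphere_minus[OF \<open>closed D\<close>]])
      (use vS \<open>v \<notin> D\<close> in auto)
  define sec where "sec F = \<Union>(closure ` {T \<in> tiles V E. \<exists>e\<in>F. e \<in> bd T})" for F
  have closed_sec: "closed (sec F)" for F
    using finite_tiles unfolding sec_def by (intro closed_UN) auto
  have ND: "x \<notin> V" "\<And>e. e \<in> E \<Longrightarrow> x \<in> path_image e \<Longrightarrow> v \<in> ends e \<and> x \<in> edge_interior e"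
    "\<And>T. T \<in> tiles V E \<Longrightarrow> x \<in> closure T \<Longrightarrow> v \<in> closure T" if x: "x \<in> N - {v}" for x
  proof -
    have xD: "x \<notin> D" "x \<noteq> v"
      using x N(3) by auto
    then show xV: "x \<notin> V"
      unfolding D_def by blast
    show "v \<in> ends e \<and> x \<in> edge_interior e" if "e \<in> E" "x \<in> path_image e" for e
      using that xD xV path_image_eq[OF that(1)] edge(5)[OF that(1)] unfolding D_def by blast
    show "v \<in> closure T" if "T \<in> tiles V E" "x \<in> closure T" for T
      using that xD unfolding D_def by blast
  qed
  have edge_tile: "\<exists>T\<in>tiles V E. e \<in> bd T \<and> path_image e \<subseteq> closure T" if "e \<in> E" for e
    using two_sides[OF that] bd_D(2) by metis
  have CC': "C \<union> C' = {e \<in> E. v \<in> ends e}"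
    using C(1) unfolding C'_def by blast
  have "N - {v} \<subseteq> sec C \<union> sec C'"
  proof
    fix x assume x: "x \<in> N - {v}"
    have "\<exists>T\<in>tiles V E. x \<in> closure T \<and> (\<exists>e\<in>E. v \<in> ends e \<and> e \<in> bd T)"
    proof (cases "x \<in> graph_points V E")
      case True
      then obtain e where e: "e \<in> E" "x \<in> path_image e"
        using ND(1)[OF x] unfolding graph_points_def by blast
      then show ?thesis
        using ND(2)[OF x e] edge_tile[OF e(1)] by blast
    next
      case False
      then obtain T where T: "T \<in> tiles V E" "x \<in> T"
        using Union_tiles x N(3) by blast
      then have xc: "x \<in> closure T"
        using closure_subset by blast
      have "v \<in> closure T - T"
        using ND(3)[OF x T(1) xc] tile(4)[OF T(1)] v unfolding graph_points_def by blast
      then have "\<exists>e\<in>bd T. v \<in> path_image e"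
        by (rule_tac tile_boundary_bd[OF T(1)]) auto
      then show ?thesis
        using T(1) xc vertex_on_edge v bd_D(1) by blast
    qed
    then show "x \<in> sec C \<union> sec C'"
      using CC' unfolding sec_def by blast
  qed
  moreover have "sec C \<inter> sec C' \<inter> (N - {v}) = {}"
  proof -
    have False if x: "x \<in> N - {v}" and T: "T \<in> tiles V E" "e \<in> C" "e \<in> bd T" "x \<in> closure T"
      and T': "T' \<in> tiles V E" "e' \<in> C'" "e' \<in> bd T'" "x \<in> closure T'" for x T T' e e'
    proof -
      have ve: "v \<in> ends e" "v \<in> ends e'" "e' \<notin> C"
        using T(2) T'(2) C(1) unfolding C'_def by auto
      have neq: "T \<noteq> T'"
        using closed[OF T(1,3) _ ve(1,2) T(2)] T'(3) ve(3) by blast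
      have "x \<notin> T"
      proof
        assume "x \<in> T"
        then obtain w where "w \<in> T'" "w \<in> T"
          using closure_openin_sphereD[OF T'(4) tile(1)[OF T(1)]] tile(5)[OF T'(1)] by blast
        then show False
          using tiles_disjoint[OF T(1) T'(1)] neq by blast
      qed
      have "x \<notin> T'"
      proof
        assume "x \<in> T'"
        then obtain w where "w \<in> T" "w \<in> T'"
          using closure_openin_sphereD[OF T(4) tile(1)[OF T'(1)]] tile(5)[OF T(1)] by blast
        then show False
          using tiles_disjoint[OF T(1) T'(1)] neq by blast
      qed
      have "\<exists>f\<in>bd T. x \<in> path_image f"
        using T(4) \<open>x \<notin> T\<close> by (rule_tac tile_boundary_bd[OF T(1)]) auto
      then obtain f where f: "f \<in> bd T" "x \<in> path_image f"
        by blast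
      have "\<exists>f\<in>bd T'. x \<in> path_image f"
        using T'(4) \<open>x \<notin> T'\<close> by (rule_tac tile_boundary_bd[OF T'(1)]) auto
      then obtain f' where f': "f' \<in> bd T'" "x \<in> path_image f'"
        by blast
      have vf: "v \<in> ends f" "x \<in> edge_interior f"
        using ND(2)[OF x bd_D(1)[OF f(1)] f(2)] by auto
      have "f = f'"
        by (rule edge_unique[OF bd_D(1)[OF f(1)] bd_D(1)[OF f'(1)] vf(2) f'(2)])
      have "f \<in> C"
        by (rule closed[OF T(1,3) f(1) ve(1) vf(1) T(2)])
      then have "e' \<in> C"
        using closed[OF T'(1) f'(1) T'(3)] vf(1) ve(2) \<open>f = f'\<close> by blast
      then show False
        using ve(3) by blast
    qed
    then show ?thesis
      unfolding sec_def by blast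
  qed
  ultimately have "sec C \<inter> (N - {v}) = {} \<or> sec C' \<inter> (N - {v}) = {}"
    using connected_closedD[OF N(4) _ _ closed_sec closed_sec] by blast
  moreover have "sec F \<inter> (N - {v}) \<noteq> {}" if F: "e \<in> F" "e \<in> E" "v \<in> ends e" for F e
  proof -
    have "v \<in> closure (edge_interior e)"
      using closure_edge_interior[OF F(2)] path_image_eq[OF F(2)] F(3) by blast
    moreover have "edge_interior e \<subseteq> S2"
      using path_image_eq[OF F(2)] edge(2)[OF F(2)] by blast
    ultimately obtain x where x: "x \<in> edge_interior e" "x \<in> N"
      using closure_openin_sphereD[OF _ N(1,2)] by blast
    then have "x \<noteq> v"
      using edge(6)[OF F(2)] v by blast
    moreover have "x \<in> sec F"
      using edge_tile[OF F(2)] F(1) x(1) path_image_eq[OF F(2)] unfolding sec_def by blast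
    ultimately show ?thesis
      using x(2) by blast
  qed
  ultimately show False
    using C C' CC' by blast
qed

end

theorem theorem1:
  shows "\<not> (\<exists>V E. pentagonal_tiling V E \<and> (\<exists>!v. v \<in> V \<and> vertex_degree E v > 3))"
proof
  assume "\<exists>V E. pentagonal_tiling V E \<and> (\<exists>!v. v \<in> V \<and> vertex_degree E v > 3)"
  then obtain V E v where tiling: "pentagonal_tiling V E" and v: "v \<in> V" "vertex_degree E v > 3"
    and unique: "\<And>u. u \<in> V \<Longrightarrow> vertex_degree E u > 3 \<Longrightarrow> u = v"
    by (elim exE conjE ex1E) blast
  interpret pentagonal_sphere V E
    by unfold_locales (use tiling in \<open>simp_all add: pentagonal_tiling_def\<close>)
  interpret pentagonal_map E "tiles V E" ends bd
  proof
    show "finite E"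
      by (rule finite_E)
    show "bd T \<subseteq> E" for T
      using bd_D(1) by blast
    show "card {T \<in> tiles V E. e \<in> bd T} = 2" if "e \<in> E" for e
      by (rule card_tiles_at_edge[OF that])
    show "\<exists>v0 v1 v2 v3 v4 g0 g1 g2 g3 g4.
        distinct [v0, v1, v2, v3, v4] \<and> distinct [g0, g1, g2, g3, g4] \<and> bd T = {g0, g1, g2, g3, g4} \<and>
        ends g0 = {v0, v1} \<and> ends g1 = {v1, v2} \<and> ends g2 = {v2, v3} \<and> ends g3 = {v3, v4} \<and>
        ends g4 = {v4, v0}" if T: "T \<in> tiles V E" for T
      by (rule tile_boundary_bd[OF T]) (intro exI conjI; assumption)
  qed
  show False
  proof (rule exceptional_vertex_contradiction[of v])
    show "card {e \<in> E. v \<in> ends e} > 3"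
      using v(2) by (simp add: vertex_degree_ends)
  next
    fix e u assume u: "e \<in> E" "u \<in> ends e" "u \<noteq> v"
    then have "u \<in> V"
      using edge(5) by blast
    then have "vertex_degree E u \<ge> 3" "\<not> vertex_degree E u > 3"
      using tiling unique u(3) unfolding pentagonal_tiling_def by blast+
    then show "card {e \<in> E. u \<in> ends e} = 3"
      by (simp add: vertex_degree_ends)
  next
    fix M :: "(real \<Rightarrow> real^3) set"
    assume M: "M \<subseteq> E" "M \<noteq> {}" "\<And>u. u \<noteq> v \<Longrightarrow> card {e \<in> M. u \<in> ends e} \<noteq> 1"
    show "\<exists>X\<subseteq>tiles V E. cut_edges X \<noteq> {} \<and> cut_edges X \<subseteq> M"
      unfolding cut_edges_def by (rule separating_tiles[OF M]) blast+
  next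
    fix C
    assume "C \<subseteq> {e \<in> E. v \<in> ends e}" "C \<noteq> {}"
      "\<And>T e e'. T \<in> tiles V E \<Longrightarrow> e \<in> bd T \<Longrightarrow> e' \<in> bd T \<Longrightarrow> v \<in> ends e \<Longrightarrow> v \<in> ends e' \<Longrightarrow> e \<in> C \<Longrightarrow> e' \<in> C"
    then show "C = {e \<in> E. v \<in> ends e}"
      by (rule vertex_link_connected[OF v(1)])
  qed
qed

end
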